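(* Let $\alpha_1,\alpha_2\in\,]1,2[$ and $q\in\,]-1,1[$. Let $X=(X_1,X_2)=(A_1^{1/2}G_1,A_2^{1/2}G_2)$, where $A_1,A_2$ are independent random variables with $A_i\sim S_{\alpha_i/2}\big((\cos\frac{\pi\alpha_i}{4})^{2/\alpha_i},1,0\big)$, $i=1,2$, and $G=(G_1,G_2)$ is a centered Gaussian vector, independent of $(A_1,A_2)$, with covariance matrix $\begin{bmatrix}1&q\\ q&1\end{bmatrix}$. Let $X(1),X(2),\ldots$ be independent random vectors with the same distribution as $X$. Let $0<p<\min(\alpha_1,\alpha_2)/4$ and let $$\hat q_n=f_p^{\leftarrow}\Big(\frac1n\sum_{t=1}^n g_p(X(t))\Big).$$ Then $\hat q_n$ is asymptotically normal; more precisely, as $n\to\infty$, $$\sqrt n\,(\hat q_n-q)\ \Rightarrow\ N\Big(0,\ f_p'(q)^{-2}\big(\mathbb{E}_q[g_p^2(X)]-f_p^2(q)\big)\Big),$$ where $\Rightarrow$ denotes convergence in law.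
   Context: For $x\in\mathbb{R}$ and $p>0$, the signed power is $x^{\langle p\rangle}:=|x|^p\,\mathrm{sgn}(x)$. $S_\alpha(\sigma,\beta,\mu)$ denotes the $\alpha$-stable law on $\mathbb{R}$ with index $\alpha$, scale $\sigma$, skewness $\beta$ and location $\mu$, in the Samorodnitsky–Taqqu parametrization; in particular, $A_i\sim S_{\alpha_i/2}\big((\cos\frac{\pi\alpha_i}{4})^{2/\alpha_i},1,0\big)$ is the positive random variable with Laplace transform $\mathbb{E}e^{-\gamma A_i}=\exp(-\gamma^{\alpha_i/2})$, $\gamma\ge 0$. Set $C_{\alpha_i,p}:=\mathbb{E}\big[A_i^{p/2}\big]$ for $i=1,2$, and $$g_p(x_1,x_2):=\frac{x_1^{\langle p\rangle}x_2^{\langle p\rangle}}{C_{\alpha_1,p}\,C_{\alpha_2,p}},\qquad (x_1,x_2)\in\mathbb{R}^2 .$$ The function $f_p:\,]-1,1[\,\to\mathbb{R}$ is defined by $f_p(r)=\mathbb{E}\big[(Z_1Z_2)^{\langle p\rangle}\big]$, where $(Z_1,Z_2)$ is a centered Gaussian vector with covariance matrix $\begin{bmatrix}1&r\\ r&1\end{bmatrix}$; it is injective, $f_p^{\leftarrow}$ denotes its inverse, defined on the range of $f_p$, and $f_p'$ its derivative. One has $f_p(q)=\mathbb{E}_q\,g_p(X)$, where $\mathbb{E}_q$ denotes expectation when the correlation parameter of $G$ is $q$. The parameters $\alpha_1,\alpha_2$ are treated as known. Convention: on the event that $\frac1n\sum_{t=1}^n g_p(X(t))$ does not belong to the range of $f_p$,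 $\hat q_n$ is assigned an arbitrary fixed value in $]-1,1[$. $N(m,v)$ is the Gaussian law with mean $m$ and variance $v$. *)

theory Defs
  imports "HOL-Probability.Probability"
begin

definition signed_pow :: "real \<Rightarrow> real \<Rightarrow> real" where
  "signed_pow x p = \<bar>x\<bar> powr p * sgn x"

(* Characteristic function of S_\<alpha>(\<sigma>, \<beta>, \<mu>) in the Samorodnitsky-Taqqu parametrization. *)
definition stable_char :: "real \<Rightarrow> real \<Rightarrow> real \<Rightarrow> real \<Rightarrow> real \<Rightarrow> complex" where
  "stable_char \<alpha> \<sigma> \<beta> \<mu> \<theta> =
    (if \<alpha> = 1
     then exp (- of_real (\<sigma> * \<bar>\<theta>\<bar>) * (1 + \<i> * of_real (\<beta> * (2 / pi) * sgn \<theta> * ln \<bar>\<theta>\<bar>))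
               + \<i> * of_real (\<mu> * \<theta>))
     else exp (- of_real (\<sigma> powr \<alpha> * \<bar>\<theta>\<bar> powr \<alpha>)
                 * (1 - \<i> * of_real (\<beta> * sgn \<theta> * tan (pi * \<alpha> / 2)))
               + \<i> * of_real (\<mu> * \<theta>)))"

definition stable_law :: "real \<Rightarrow> real \<Rightarrow> real \<Rightarrow> real \<Rightarrow> real measure \<Rightarrow> bool" where
  "stable_law \<alpha> \<sigma> \<beta> \<mu> N \<longleftrightarrow>
     0 < \<alpha> \<and> \<alpha> \<le> 2 \<and> 0 \<le> \<sigma> \<and> -1 \<le> \<beta> \<and> \<beta> \<le> 1 \<and>
     real_distribution N \<and> (\<forall>\<theta>. char N \<theta> = stable_char \<alpha> \<sigma> \<beta> \<mu> \<theta>)"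

(* Density of the centered Gaussian law on the plane with covariance matrix [[1, r], [r, 1]];
   meaningful for -1 < r < 1, where this matrix has determinant 1 - r^2 > 0. *)
definition bivar_normal_density :: "real \<Rightarrow> real \<times> real \<Rightarrow> real" where
  "bivar_normal_density r = (\<lambda>(x, y).
     1 / (2 * pi * sqrt (1 - r\<^sup>2)) * exp (- (x\<^sup>2 - 2 * r * x * y + y\<^sup>2) / (2 * (1 - r\<^sup>2))))"

definition bivar_normal :: "real \<Rightarrow> (real \<times> real) measure" where
  "bivar_normal r = density lborel (\<lambda>z. ennreal (bivar_normal_density r z))"

(* Used only for r in the open interval (-1, 1). *)
definition f_fun :: "real \<Rightarrow> real \<Rightarrow> real" where
  "f_fun p r = (\<integral>z. signed_pow (fst z * snd z) p \<partial>(bivar_normal r))"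

(* C1 and C2 stand for the moments E[A_i^(p/2)]. *)
definition g_fun :: "real \<Rightarrow> real \<Rightarrow> real \<Rightarrow> real \<times> real \<Rightarrow> real" where
  "g_fun p C1 C2 x = signed_pow (fst x) p * signed_pow (snd x) p / (C1 * C2)"

(* The inverse of f_fun p restricted to (-1, 1), extended by the constant c outside its range. *)
definition f_inv :: "real \<Rightarrow> real \<Rightarrow> real \<Rightarrow> real" where
  "f_inv p c y = (if y \<in> f_fun p ` {-1<..<1} then inv_into {-1<..<1} (f_fun p) y else c)"

definition q_hat ::
  "real \<Rightarrow> real \<Rightarrow> real \<Rightarrow> real \<Rightarrow> (nat \<Rightarrow> 'a \<Rightarrow> real \<times> real) \<Rightarrow> nat \<Rightarrow> 'a \<Rightarrow> real" where
  "q_hat p C1 C2 c Xs n \<omega> = f_inv p c (1 / real n * (\<Sum>t=1..n. g_fun p C1 C2 (Xs t \<omega>)))"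

end

theory Submission
  imports Defs "HOL-Complex_Analysis.Complex_Analysis"
begin

text \<open>
  The law of A with characteristic function exp (-(-it)^a), 0 < a < 1, lives on the nonnegative
  half-line because in the inversion formula for an interval to the left of 0 the contour can be
  closed in the upper half-plane, where (-iz)^a has nonnegative real part. Its moments of order
  s < a are finite because E|A|^s is a constant multiple of the integral of
  (1 - Re char(t)) t^(-1-s) over t > 0. By independence, g(X) then has mean f(q) and finite
  second moment, so the central limit theorem applies, and the delta method transfers it through
  the inverse of f.

  For the latter, f is differentiated through the Gaussian density, while strict monotonicity with
  a positive derivative comes from the polarization Z1 Z2 = ((1 + r) U^2 - (1 - r) V^2) / 2 with
  U, V independent standard normal: the increment of the right-hand side in r is
  (U^2 + V^2) / 2 per unit of r.
\<close>

section \<open>One-sided stable laws\<close>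

text \<open>The laws of \<open>A1\<close> and \<open>A2\<close> are given only by their
  characteristic functions, so support and moments are both read off exp(-w^a) with w = -it and a =
  \<alpha>/2. On the right half-plane Re(w^a) >= cos(pi a/2) |w|^a: this yields the decay on large
  arcs and excludes the point mass at 0. The identity |w^a| = |w|^a gives the order a of 1 - Re char
  at 0, hence the range s < a of the moments.

  Two forms of f are used because each hides what the other shows. In the density form r enters
  smoothly, but the score changes sign, so a vanishing derivative is not excluded. In the polarized
  form the integrand increases with r, but for p < 1 its slope is infinite where (1 + r) U^2 = (1 -
  r) V^2. Only a linear lower bound on increments is taken from it; that bound passes to the
  derivative and also makes the inverse Lipschitz.

  The central limit theorem needs a strictly positive variance. This reduces to the Gaussian factor,
  since by Jensen's inequality the factors A_i can only enlarge the second moment of g.\<close>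

lemma cos_pi_half_mult_pos:
  assumes "0 < a" "a < 1"
  shows "0 < cos (pi * a / 2)"
proof (rule cos_gt_zero_pi)
  show "- (pi / 2) < pi * a / 2" "pi * a / 2 < pi / 2"
    using mult_pos_pos[OF pi_gt_zero assms(1)] mult_strict_left_mono[OF assms(2) pi_gt_zero] by linarith+
qed

text \<open>A nonzero point of the closed right half-plane has argument at most pi/2 in absolute
  value, so its principal power has argument at most \<open>pi * a / 2\<close>, where the cosine is
  at least \<open>cos (pi * a / 2)\<close>.\<close>

lemma Re_powr_ge:
  assumes "0 < a" "a \<le> 1" "0 \<le> Re w"
  shows "cos (pi * a / 2) * norm w powr a \<le> Re (w powr of_real a)"
proof (cases "w = 0")
  case False
  have "\<bar>Im (Ln w)\<bar> \<le> pi / 2"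
    using Re_Ln_pos_le[OF False] assms(3) by simp
  then have "\<bar>a * Im (Ln w)\<bar> \<le> pi * a / 2"
    using assms by (simp add: abs_mult mult_left_mono mult.commute)
  moreover have "pi * a / 2 \<le> pi"
    using assms mult_left_le[of a pi] pi_gt_zero by linarith
  ultimately have "cos (pi * a / 2) \<le> cos \<bar>a * Im (Ln w)\<bar>"
    by (intro cos_monotone_0_pi_le) auto
  then show ?thesis
    using False by (simp add: powr_def Re_exp mult.commute mult_left_mono)
qed auto

text \<open>The factor \<open>- \<i>\<close> turns the upper half-plane into the right one. This
  decay is what permits closing the contour upwards.\<close>

lemma norm_exp_neg_powr_le:
  assumes "0 < a" "a \<le> 1" "0 \<le> Im z"
  shows "norm (exp (- ((- \<i> * z) powr of_real a))) \<le> exp (- cos (pi * a / 2) * norm z powr a)"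
  using Re_powr_ge[of a "- \<i> * z"] assms by (simp add: norm_mult)

text \<open>The scale is chosen so that its a-th power is cos(pi a/2). Multiplied by 1 -+ i tan(pi
  a/2) this becomes exp(-+ i pi a/2), the phase of the principal power of -i\<theta>, whose base has
  argument -+ pi/2 according to the sign of \<theta>.\<close>

lemma stable_char_one_sided:
  assumes "0 < a" "a < 1"
  shows "stable_char a (cos (pi * a / 2) powr (1 / a)) 1 0 \<theta> = exp (- ((- \<i> * of_real \<theta>) powr of_real a))"
proof -
  have c: "0 < cos (pi * a / 2)"
    by (rule cos_pi_half_mult_pos[OF assms])
  have s: "(cos (pi * a / 2) powr (1 / a)) powr a = cos (pi * a / 2)"
    using assms c by (simp add: powr_powr)
  consider "\<theta> = 0" | "\<theta> > 0" | "\<theta> < 0" by linarith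
  then show ?thesis
  proof cases
    case 1
    then show ?thesis using assms by (simp add: stable_char_def)
  next
    case 2
    have "Ln (- \<i> * of_real \<theta>) = of_real (ln \<theta>) - \<i> * (pi / 2)"
      using 2 Ln_times_of_real[of \<theta> "- \<i>"] by (simp add: mult.commute Ln_of_real)
    then have pw: "(- \<i> * of_real \<theta>) powr of_real a = of_real (\<theta> powr a) * (cos (pi * a / 2) - \<i> * sin (pi * a / 2))"
      using 2 assms by (simp add: powr_def complex_eq_iff Re_exp Im_exp mult.commute)
    show ?thesis
      unfolding pw using 2 assms c by (simp add: stable_char_def s tan_def algebra_simps)
  next
    case 3
    have "Ln (- \<i> * of_real \<theta>) = of_real (ln (-\<theta>)) + \<i> * (pi / 2)"
      using 3 Ln_times_of_real[of "-\<theta>" "\<i>"] Ln_of_real[of "-\<theta>"] by (simp add: mult.commute)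
    then have "(- \<i> * of_real \<theta>) powr of_real a = exp (of_real a * (of_real (ln (-\<theta>)) + \<i> * (pi / 2)))"
      using 3 by (simp add: powr_def)
    also have "\<dots> = of_real ((-\<theta>) powr a) * (cos (pi * a / 2) + \<i> * sin (pi * a / 2))"
      using 3 by (simp add: powr_def complex_eq_iff Re_exp Im_exp mult.commute)
    finally have pw: "(- \<i> * of_real \<theta>) powr of_real a = of_real ((-\<theta>) powr a) * (cos (pi * a / 2) + \<i> * sin (pi * a / 2))" .
    show ?thesis
      unfolding pw using 3 assms c by (simp add: stable_char_def s tan_def algebra_simps)
  qed
qed

text \<open>Cauchy's theorem for the segment closed by a semicircle of length \<open>pi * R\<close>.
  Holomorphy is asked only in the open half-plane, with continuity up to the boundary, because the
  intended integrand has a branch point at 0, on the segment itself.\<close>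

lemma norm_integral_le_upper_half_plane:
  fixes F :: "complex \<Rightarrow> complex"
  assumes cont: "continuous_on {z. 0 \<le> Im z} F"
    and diff: "\<And>z. 0 < Im z \<Longrightarrow> F field_differentiable at z"
    and bound: "\<And>z. 0 \<le> Im z \<Longrightarrow> norm z = R \<Longrightarrow> norm (F z) \<le> B"
    and R: "0 < R" and B: "0 \<le> B"
  shows "norm (integral {-R..R} (\<lambda>t. F (of_real t))) \<le> B * R * pi"
proof -
  let ?l = "linepath (of_real (-R)) (of_real R) :: real \<Rightarrow> complex"
  let ?c = "part_circlepath 0 R 0 pi"
  have pi_c: "path_image ?c \<subseteq> {z. 0 \<le> Im z \<and> norm z = R}"
    using R by (auto simp: path_image_part_circlepath Im_exp sin_ge_zero norm_mult)
  have pi_l: "path_image ?l \<subseteq> {z. 0 \<le> Im z}"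
    by (auto simp: linepath_def path_image_def)
  have ends: "pathfinish ?l = pathstart ?c" "pathfinish ?c = pathstart ?l"
    using R by (auto simp: cis_conv_exp[symmetric])
  have "(F has_contour_integral 0) (?l +++ ?c)"
  proof (rule Cauchy_theorem_convex[OF cont _ finite.emptyI])
    show "convex {z. 0 \<le> Im z}"
      using convex_halfspace_Im_ge[of 0] by simp
    have "interior {z. 0 \<le> Im z} = {z. 0 < Im z}"
      using interior_halfspace_ge[of \<i> 0] by (simp add: inner_complex_def)
    then show "F field_differentiable at z" if "z \<in> interior {z. 0 \<le> Im z} - {}" for z
      using that diff by auto
    show "valid_path (?l +++ ?c)"
      using ends by (intro valid_path_join) auto
    show "path_image (?l +++ ?c) \<subseteq> {z. 0 \<le> Im z}"
      using pi_c pi_l by (intro path_image_join_subset[THEN order_trans]) blast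
  qed (use ends in auto)
  moreover have il: "F contour_integrable_on ?l"
    using continuous_on_subset[OF cont pi_l] by (intro contour_integrable_continuous_linepath) simp
  moreover have ic: "F contour_integrable_on ?c"
    using pi_c by (intro contour_integrable_continuous_part_circlepath continuous_on_subset[OF cont]) auto
  ultimately have "contour_integral ?l F + contour_integral ?c F = 0"
    using contour_integral_join[of F ?l ?c] by (metis contour_integral_unique ends(1) valid_path_linepath valid_path_part_circlepath)
  then have "norm (contour_integral ?l F) = norm (contour_integral ?c F)"
    by (metis add_eq_0_iff norm_minus_cancel)
  also have "\<dots> \<le> B * R * \<bar>pi - 0\<bar>"
    using pi_c bound B R by (intro contour_integral_bound_part_circlepath ic) auto
  finally show ?thesis
    using R by (simp add: contour_integral_linepath_Reals_eq)
qed

text \<open>Levy's inversion formula gives the mass as a limit of integrals over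
  \<open>{-T..T}\<close>, provided the endpoints are not atoms. On the semicircle the kernel is at
  most 2/T, which cancels the growth of the arc length, so the integral is bounded by a constant
  times exp(-cos(pi a/2) T^a) and tends to 0.\<close>

lemma (in real_distribution) measure_eq_0_one_sided_char:
  assumes a: "0 < a" "a \<le> 1" and c: "0 < cos (pi * a / 2)"
    and char: "\<And>t. char M t = exp (- ((- \<i> * of_real t) powr of_real a))"
    and uv: "u < v" "v \<le> 0" and atoms: "measure M {u} = 0" "measure M {v} = 0"
  shows "measure M {u<..v} = 0"
proof -
  define e where "e z = exp (- \<i> * z * u) - exp (- \<i> * z * v)" for z :: complex
  \<comment> \<open>The inversion kernel with its removable singularity filled: \<open>v - u\<close>
    is the limit of the quotient at 0, since e has derivative i(v - u) there. This makes
    \<open>F\<close> continuous up to the origin.\<close>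
  define K where "K z = (if z = 0 then of_real (v - u) else e z / (\<i> * z))" for z
  define F where "F z = K z * exp (- ((- \<i> * z) powr of_real a))" for z
  have e_diff: "(e has_field_derivative \<i> * (v - u)) (at 0)"
    unfolding e_def by (auto intro!: derivative_eq_intros simp: algebra_simps)
  have isCont_K: "isCont K z" for z
  proof (cases "z = 0")
    case True
    have "((\<lambda>z. e z / z * inverse \<i>) \<longlongrightarrow> \<i> * (v - u) * inverse \<i>) (at 0)"
      using e_diff by (intro tendsto_intros) (auto simp: has_field_derivative_iff e_def)
    moreover have "\<i> * (v - u) * inverse \<i> = K 0"
      by (simp add: K_def complex_eq_iff)
    ultimately have "((\<lambda>z. e z / z * inverse \<i>) \<longlongrightarrow> K 0) (at 0)"
      by (simp only:)
    moreover have "e z / z * inverse \<i> = K z" if "z \<noteq> 0" for z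
      using that unfolding K_def by (simp only: if_False divide_inverse inverse_mult_distrib mult_ac)
    ultimately have "(K \<longlongrightarrow> K 0) (at 0)"
      using Lim_transform_within[of _ "K 0" 0 UNIV 1 K] by simp
    then show ?thesis using True by (simp add: isCont_def)
  next
    case False
    have "isCont (\<lambda>z. e z / (\<i> * z)) z"
      using False unfolding e_def by (intro continuous_intros) auto
    moreover have "\<forall>\<^sub>F w in nhds z. K w = e w / (\<i> * w)"
      using t1_space_nhds[OF False] by eventually_elim (simp add: K_def)
    ultimately show ?thesis
      by (simp only: isCont_cong[of K "\<lambda>w. e w / (\<i> * w)" z])
  qed
  have cont: "continuous_on {z. 0 \<le> Im z} F"
    unfolding F_def using a isCont_K
    by (intro continuous_intros continuous_at_imp_continuous_on) auto
  have diff: "F field_differentiable at z" if "0 < Im z" for z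
  proof -
    have "(\<lambda>z. e z / (\<i> * z) * exp (- ((- \<i> * z) powr of_real a))) holomorphic_on {z. 0 < Im z}"
      unfolding e_def by (intro holomorphic_intros) (auto simp: complex_nonpos_Reals_iff)
    then have "F holomorphic_on {z. 0 < Im z}"
      by (rule holomorphic_transform) (auto simp: F_def K_def)
    then show ?thesis
      using that holomorphic_on_imp_differentiable_at[OF _ open_halfspace_Im_gt[of 0]] by simp
  qed
  have bound: "norm (F z) \<le> 2 / R * exp (- cos (pi * a / 2) * R powr a)"
    if z: "0 \<le> Im z" "norm z = R" and R: "0 < R" for z R
  proof -
    have "norm (e z) \<le> norm (exp (- \<i> * z * u)) + norm (exp (- \<i> * z * v))"
      unfolding e_def by (rule norm_triangle_ineq4)
    \<comment> \<open>The position of the interval enters here: |exp(-izu)| = exp(u Im z) <= 1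
      because u <= 0, and likewise for v.\<close>
    also have "\<dots> \<le> 1 + 1"
      using z uv by (intro add_mono) (auto simp: mult_nonneg_nonpos)
    finally have "norm (K z) \<le> 2 / R"
      using z R by (auto simp: K_def norm_divide norm_mult divide_right_mono)
    then show ?thesis
      unfolding F_def norm_mult
      using norm_exp_neg_powr_le[OF a z(1)] z R by (intro mult_mono) auto
  qed
  have int: "norm (integral {-R..R} (\<lambda>t. F (of_real t))) \<le> 2 * pi * exp (- cos (pi * a / 2) * R powr a)"
    if "0 < R" for R
  proof -
    have "norm (integral {-R..R} (\<lambda>t. F (of_real t))) \<le> 2 / R * exp (- cos (pi * a / 2) * R powr a) * R * pi"
      using that by (intro norm_integral_le_upper_half_plane cont diff bound) auto
    also have "\<dots> = 2 * pi * exp (- cos (pi * a / 2) * R powr a)"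
      using that by simp
    finally show ?thesis .
  qed
  have "(CLBINT t=-T..T. (iexp (-(t * u)) - iexp (-(t * v))) / (\<i> * t) * char M t) = integral {-T..T} (\<lambda>t. F (of_real t))"
    if T: "0 < T" for T :: real
  proof -
    have "continuous_on {-T..T} (\<lambda>t. F (of_real t))"
      by (intro continuous_on_compose2[OF cont] continuous_intros) auto
    then have si: "set_integrable lborel {-T..T} (\<lambda>t. F (of_real t))"
      by (rule borel_integrable_compact[rotated, folded set_integrable_def]) simp
    \<comment> \<open>At t = 0 the quotient is 0 by the convention on division, whereas
      \<open>K\<close> takes the value \<open>v - u\<close>; a single point does not affect the
      integral.\<close>
    have "(CLBINT t=-T..T. (iexp (-(t * u)) - iexp (-(t * v))) / (\<i> * t) * char M t) =
        (CLBINT t=-T..T. F (of_real t))"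
      by (rule interval_integral_discrete_difference[of "{0}"])
         (auto simp: F_def K_def e_def char algebra_simps)
    also have "\<dots> = integral {-T..T} (\<lambda>t. F (of_real t))"
      using T si by (intro interval_integral_eq_integral) auto
    finally show ?thesis .
  qed
  then have "eventually (\<lambda>T. norm (1 / (2 * pi) * (CLBINT t=-T..T. (iexp (-(t * u)) - iexp (-(t * v))) / (\<i> * t) * char M t))
     \<le> exp (- cos (pi * a / 2) * real T powr a)) sequentially"
    using int
    by (intro eventually_sequentiallyI[of 1]) (simp add: norm_mult norm_divide field_simps)
  moreover have "((\<lambda>T. exp (- cos (pi * a / 2) * real T powr a)) \<longlonglongrightarrow> 0)"
    using a c by real_asymp
  ultimately have "(\<lambda>T::nat. 1 / (2 * pi) * (CLBINT t=-T..T. (iexp (-(t * u)) - iexp (-(t * v))) / (\<i> * t) * char M t)) \<longlonglongrightarrow> 0"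
    by (rule Lim_null_comparison)
  moreover have "(\<lambda>T::nat. 1 / (2 * pi) * (CLBINT t=-T..T. (iexp (-(t * u)) - iexp (-(t * v))) / (\<i> * t) * char M t)) \<longlonglongrightarrow> measure M {u<..v}"
    using Levy_Inversion[of u v] uv atoms by simp
  ultimately show ?thesis
    using LIMSEQ_unique by fastforce
qed

text \<open>Inversion only handles endpoints that are not atoms. Atoms are countable, so every
  nonempty open interval contains a non-atom, and countably many admissible intervals exhaust the
  negative half-line.\<close>

lemma (in real_distribution) AE_nonneg_one_sided_char:
  assumes a: "0 < a" "a < 1"
    and char: "\<And>t. char M t = exp (- ((- \<i> * of_real t) powr of_real a))"
  shows "AE x in M. 0 \<le> x"
proof -
  have c: "0 < cos (pi * a / 2)"
    by (rule cos_pi_half_mult_pos[OF a])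
  have no_atom: "\<exists>z. x < z \<and> z < y \<and> measure M {z} = 0" if "x < y" for x y
  proof (rule ccontr)
    assume "\<not> ?thesis"
    then have "{x<..<y} \<subseteq> {z. 0 < measure M {z}}"
      by (auto simp: zero_less_measure_iff)
    then have "countable {x<..<y}"
      using countable_atoms countable_subset by blast
    then show False using that uncountable_open_interval[of x y] by simp
  qed
  \<comment> \<open>The windows put \<open>u n\<close> to the left of -1 and \<open>v n\<close> to
    the right of it for every n, so \<open>u n < v n\<close>, while \<open>u n\<close> tends to
    minus infinity and \<open>v n\<close> to 0.\<close>
  have "\<forall>n::nat. \<exists>u. - real n - 2 < u \<and> u < - real n - 1 \<and> measure M {u} = 0"
    by (intro allI no_atom) auto
  then obtain u where u: "\<And>n::nat. - real n - 2 < u n \<and> u n < - real n - 1 \<and> measure M {u n} = 0"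
    by metis
  have "\<forall>n::nat. \<exists>v. - inverse (real (Suc n)) < v \<and> v < 0 \<and> measure M {v} = 0"
    by (intro allI no_atom) auto
  then obtain v where v: "\<And>n::nat. - inverse (real (Suc n)) < v n \<and> v n < 0 \<and> measure M {v n} = 0"
    by metis
  have null: "{u n<..v n} \<in> null_sets M" for n
  proof -
    have "inverse (real (Suc n)) \<le> 1" by (simp add: field_simps)
    then have "u n < v n" using u[of n] v[of n] by linarith
    then have "measure M {u n<..v n} = 0"
      using u[of n] v[of n] by (intro measure_eq_0_one_sided_char[OF a(1) _ c char]) (use a in auto)
    then show ?thesis by (auto simp: null_sets_def emeasure_eq_measure)
  qed
  have "{..<0} \<subseteq> (\<Union>n. {u n<..v n})"
  proof
    fix x :: real assume "x \<in> {..<0}"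
    then obtain m k where m: "inverse (real (Suc m)) < - x" and k: "- x < real k"
      using reals_Archimedean[of "-x"] reals_Archimedean2[of "-x"] by auto
    have "inverse (real (Suc (max m k))) \<le> inverse (real (Suc m))"
      by (simp add: field_simps)
    moreover have "- real (max m k) - 1 < x"
      using k by simp
    ultimately have "x \<in> {u (max m k)<..v (max m k)}"
      using m u[of "max m k"] v[of "max m k"] unfolding greaterThanAtMost_iff by linarith
    then show "x \<in> (\<Union>n. {u n<..v n})" by blast
  qed
  then show ?thesis
    using null by (intro AE_I'[of "\<Union>n. {u n<..v n}"]) (auto simp: null_sets_UN not_le)
qed

text \<open>Split 1 - e^(-x) cos y as (1 - e^(-x)) + e^(-x) (1 - cos y); the parts are at most x and
  |y|. With w = (-it)^a this turns the characteristic function into the bound 1 - Re char <= 2 t^a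
  near 0.\<close>

lemma one_minus_Re_exp_neg_le:
  assumes "0 \<le> Re w"
  shows "1 - Re (exp (- w)) \<le> 2 * norm w"
proof -
  have "1 - cos (Im w) = 2 * (sin (Im w / 2))\<^sup>2"
    using cos_double_sin[of "Im w / 2"] by simp
  also have "\<dots> \<le> 2 * \<bar>sin (Im w / 2)\<bar>"
    using mult_left_le[OF abs_sin_le_one abs_ge_zero, of "sin (Im w / 2)" "Im w / 2"]
    by (simp add: power2_eq_square)
  also have "\<dots> \<le> \<bar>Im w\<bar>"
    using abs_sin_x_le_abs_x[of "Im w / 2"] by simp
  finally have c: "1 - cos (Im w) \<le> \<bar>Im w\<bar>" .
  have "1 - Re (exp (- w)) = (1 - exp (- Re w)) + exp (- Re w) * (1 - cos (Im w))"
    by (simp add: Re_exp algebra_simps)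
  also have "\<dots> \<le> Re w + 1 * \<bar>Im w\<bar>"
    using c assms exp_ge_add_one_self[of "- Re w"] by (intro add_mono mult_mono) auto
  also have "\<dots> \<le> 2 * norm w"
    using abs_Re_le_cmod[of w] abs_Im_le_cmod[of w] by linarith
  finally show ?thesis .
qed

section \<open>Fractional absolute moments read off a characteristic function\<close>

definition frac_moment_const :: "real \<Rightarrow> ennreal" where
  "frac_moment_const s = (\<integral>\<^sup>+t. ennreal (indicator {0<..} t * ((1 - cos t) * t powr (- 1 - s))) \<partial>lborel)"

text \<open>
  The constant may be infinite for large s; only its positivity matters for bounding moments from above.
\<close>

lemma frac_moment_const_pos: "0 < frac_moment_const s"
proof -
  let ?m = "min (1 powr (- 1 - s)) (2 powr (- 1 - s))"
  \<comment> \<open>The interval [1, 2] lies in [0, pi], where cosine decreases. The power is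
    monotone in a direction that depends on the sign of its exponent, hence the minimum over both
    endpoints.\<close>
  have *: "(1 - cos 1) * ?m \<le> (1 - cos t) * t powr (- 1 - s)" if "t \<in> {1..2}" for t :: real
  proof (intro mult_mono)
    show "1 - cos 1 \<le> 1 - cos t"
      using that pi_ge_two cos_monotone_0_pi_le[of 1 t] by simp
    show "?m \<le> t powr (- 1 - s)"
      using that by (cases "0 \<le> - 1 - s") (auto simp: min_le_iff_disj ge_one_powr_ge_zero intro: powr_mono2 powr_mono2')
  qed auto
  have "0 < (1 - cos (1::real)) * ?m"
    using cos_monotone_0_pi[of 0 1] pi_ge_two by simp
  then have "0 < ennreal ((1 - cos 1) * ?m) * emeasure lborel {1..2::real}"
    by (simp add: ennreal_zero_less_mult_iff)
  also have "\<dots> = (\<integral>\<^sup>+t. ennreal ((1 - cos 1) * ?m) * indicator {1..2::real} t \<partial>lborel)"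
    by (simp add: nn_integral_cmult_indicator)
  also have "\<dots> \<le> frac_moment_const s"
    unfolding frac_moment_const_def
    using * by (intro nn_integral_mono) (auto simp: indicator_def intro!: ennreal_leI)
  finally show ?thesis .
qed

text \<open>For x nonzero, substituting t/|x| for t removes x from the cosine and leaves
  |x|^(1+s)/|x| in front. Integrated over a law, the left side sees only the real part of the
  characteristic function.\<close>

lemma nn_integral_one_minus_cos:
  assumes s: "0 < s"
  shows "(\<integral>\<^sup>+t. ennreal (indicator {0<..} t * ((1 - cos (t * x)) * t powr (- 1 - s))) \<partial>lborel)
    = ennreal (\<bar>x\<bar> powr s) * frac_moment_const s"
proof (cases "x = 0")
  case False
  have "(\<integral>\<^sup>+t. ennreal (indicator {0<..} t * ((1 - cos (t * x)) * t powr (- 1 - s))) \<partial>lborel)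
    = ennreal \<bar>1 / \<bar>x\<bar>\<bar> * (\<integral>\<^sup>+t. ennreal (indicator {0<..} (0 + 1 / \<bar>x\<bar> * t) *
        ((1 - cos ((0 + 1 / \<bar>x\<bar> * t) * x)) * (0 + 1 / \<bar>x\<bar> * t) powr (- 1 - s))) \<partial>lborel)"
    using False by (intro nn_integral_real_affine) auto
  also have "(\<integral>\<^sup>+t. ennreal (indicator {0<..} (0 + 1 / \<bar>x\<bar> * t) *
        ((1 - cos ((0 + 1 / \<bar>x\<bar> * t) * x)) * (0 + 1 / \<bar>x\<bar> * t) powr (- 1 - s))) \<partial>lborel)
      = (\<integral>\<^sup>+t. ennreal (\<bar>x\<bar> powr (1 + s)) * ennreal (indicator {0<..} t * ((1 - cos t) * t powr (- 1 - s))) \<partial>lborel)"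
  proof (intro nn_integral_cong)
    fix t :: real
    have "cos (t * x / \<bar>x\<bar>) = cos t"
      using False by (cases "0 < x") auto
    moreover have "(t / \<bar>x\<bar>) powr (- 1 - s) = \<bar>x\<bar> powr (1 + s) * t powr (- 1 - s)" if "0 < t"
      using False that by (simp add: powr_divide powr_minus_divide[of "\<bar>x\<bar>" "1 + s", simplified] field_simps)
    ultimately show "ennreal (indicator {0<..} (0 + 1 / \<bar>x\<bar> * t) *
        ((1 - cos ((0 + 1 / \<bar>x\<bar> * t) * x)) * (0 + 1 / \<bar>x\<bar> * t) powr (- 1 - s)))
      = ennreal (\<bar>x\<bar> powr (1 + s)) * ennreal (indicator {0<..} t * ((1 - cos t) * t powr (- 1 - s)))"
      using False by (auto simp: indicator_def zero_less_divide_iff ennreal_mult[symmetric] mult_ac)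
  qed
  also have "\<dots> = ennreal (\<bar>x\<bar> powr (1 + s)) * frac_moment_const s"
    unfolding frac_moment_const_def by (intro nn_integral_cmult) auto
  also have "ennreal \<bar>1 / \<bar>x\<bar>\<bar> * (ennreal (\<bar>x\<bar> powr (1 + s)) * frac_moment_const s)
      = ennreal (\<bar>x\<bar> powr s) * frac_moment_const s"
    using False by (simp add: mult.assoc[symmetric] ennreal_mult[symmetric] powr_add)
  finally show ?thesis .
qed simp

lemma nn_integral_powr_near_0:
  assumes "-1 < e"
  shows "(\<integral>\<^sup>+t. ennreal (indicator {0<..1} t * t powr e) \<partial>lborel) < \<infinity>"
proof -
  have "(\<integral>\<^sup>+t. ennreal (indicator {0<..1} t * t powr e) \<partial>lborel) \<le> (\<integral>\<^sup>+t. ennreal (indicator {0..1} t * t powr e) \<partial>lborel)"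
    by (intro nn_integral_mono) (auto simp: indicator_def)
  also have "\<dots> = ennreal (1 powr (e + 1) / (e + 1))"
    using has_integral_powr_from_0[OF assms, of 1]
    by (subst nn_integral_has_integral_lebesgue) auto
  finally show ?thesis by (simp add: le_less_trans)
qed

lemma nn_integral_powr_near_top:
  assumes "e < -1"
  shows "(\<integral>\<^sup>+t. ennreal (indicator {1<..} t * t powr e) \<partial>lborel) < \<infinity>"
proof -
  have "(\<integral>\<^sup>+t. ennreal (indicator {1<..} t * t powr e) \<partial>lborel) \<le> (\<integral>\<^sup>+t. ennreal (indicator {1..} t * t powr e) \<partial>lborel)"
    by (intro nn_integral_mono) (auto simp: indicator_def)
  also have "\<dots> = ennreal (- (1 powr (e + 1)) / (e + 1))"
    using has_integral_powr_to_inf[OF assms, of 1]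
    by (subst nn_integral_has_integral_lebesgue) auto
  finally show ?thesis by (simp add: le_less_trans)
qed

text \<open>By Tonelli the moment times the constant equals the integral of (1 - Re char) t^(-1-s).
  Near 0 the hypothesis leaves t^(a-1-s), integrable since s < a; beyond 1 the trivial bound 2
  leaves t^(-1-s), integrable since s > 0. As the constant is positive, finiteness of the product
  forces finiteness of the moment.\<close>

lemma (in real_distribution) integrable_abs_powr_if_char_bound:
  assumes s: "0 < s" "s < a"
    and bound: "\<And>t. 0 < t \<Longrightarrow> 1 - Re (char M t) \<le> 2 * t powr a"
  shows "integrable M (\<lambda>x. \<bar>x\<bar> powr s)"
proof -
  interpret P: pair_sigma_finite lborel M ..
  have Re_char: "Re (char M t) = (\<integral>x. cos (t * x) \<partial>M)" for t
  proof -
    have "integrable M (\<lambda>x. iexp (t * x))"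
      by (intro integrable_iexp) auto
    then show ?thesis
      unfolding char_def by (subst integral_Re[symmetric]) (auto simp: Re_exp)
  qed
  have cosi: "integrable M (\<lambda>x. cos (t * x))" for t
    by (intro integrable_const_bound[where B = 1]) auto
  have inner: "(\<integral>\<^sup>+x. ennreal (1 - cos (t * x)) \<partial>M) = ennreal (1 - Re (char M t))" for t
  proof -
    have "(\<integral>\<^sup>+x. ennreal (1 - cos (t * x)) \<partial>M) = ennreal (\<integral>x. 1 - cos (t * x) \<partial>M)"
      using cosi by (intro nn_integral_eq_integral) auto
    also have "(\<integral>x. 1 - cos (t * x) \<partial>M) = 1 - Re (char M t)"
      using cosi prob_space by (simp add: Re_char Bochner_Integration.integral_diff)
    finally show ?thesis .
  qed
  have "(\<integral>\<^sup>+x. ennreal (\<bar>x\<bar> powr s) \<partial>M) * frac_moment_const s = (\<integral>\<^sup>+x. ennreal (\<bar>x\<bar> powr s) * frac_moment_const s \<partial>M)"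
    by (intro nn_integral_multc[symmetric]) auto
  also have "\<dots> = (\<integral>\<^sup>+x. \<integral>\<^sup>+t. ennreal (indicator {0<..} t * ((1 - cos (t * x)) * t powr (- 1 - s))) \<partial>lborel \<partial>M)"
    by (simp add: nn_integral_one_minus_cos[OF s(1)])
  also have "\<dots> = (\<integral>\<^sup>+t. \<integral>\<^sup>+x. ennreal (indicator {0<..} t * ((1 - cos (t * x)) * t powr (- 1 - s))) \<partial>M \<partial>lborel)"
    by (intro P.Fubini') measurable
  also have "\<dots> = (\<integral>\<^sup>+t. ennreal (indicator {0<..} t * t powr (- 1 - s)) * ennreal (1 - Re (char M t)) \<partial>lborel)"
  proof (intro nn_integral_cong)
    fix t :: real
    have "(\<integral>\<^sup>+x. ennreal (indicator {0<..} t * ((1 - cos (t * x)) * t powr (- 1 - s))) \<partial>M)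
      = (\<integral>\<^sup>+x. ennreal (indicator {0<..} t * t powr (- 1 - s)) * ennreal (1 - cos (t * x)) \<partial>M)"
      by (intro nn_integral_cong) (simp add: ennreal_mult[symmetric] mult_ac)
    also have "\<dots> = ennreal (indicator {0<..} t * t powr (- 1 - s)) * (\<integral>\<^sup>+x. ennreal (1 - cos (t * x)) \<partial>M)"
      by (intro nn_integral_cmult) auto
    finally show "(\<integral>\<^sup>+x. ennreal (indicator {0<..} t * ((1 - cos (t * x)) * t powr (- 1 - s))) \<partial>M)
       = ennreal (indicator {0<..} t * t powr (- 1 - s)) * ennreal (1 - Re (char M t))"
      by (simp add: inner)
  qed
  also have "\<dots> \<le> (\<integral>\<^sup>+t. 2 * ennreal (indicator {0<..1} t * t powr (a - 1 - s)) + 2 * ennreal (indicator {1<..} t * t powr (- 1 - s)) \<partial>lborel)"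
  proof (intro nn_integral_mono)
    fix t :: real
    have le2: "1 - Re (char M t) \<le> 2"
      using cmod_char_le_1[of t] abs_Re_le_cmod[of "char M t"] by linarith
    consider "t \<le> 0" | "0 < t" "t \<le> 1" | "1 < t" by linarith
    then show "ennreal (indicator {0<..} t * t powr (- 1 - s)) * ennreal (1 - Re (char M t))
      \<le> 2 * ennreal (indicator {0<..1} t * t powr (a - 1 - s)) + 2 * ennreal (indicator {1<..} t * t powr (- 1 - s))"
    proof cases
      case 2
      have "t powr (- 1 - s) * (1 - Re (char M t)) \<le> t powr (- 1 - s) * (2 * t powr a)"
        using bound[OF 2(1)] by (intro mult_left_mono) auto
      also have "\<dots> = 2 * t powr (a - 1 - s)"
        using 2 by (simp add: powr_add[symmetric] algebra_simps)
      finally show ?thesis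
        using 2 by (simp add: ennreal_mult'[symmetric] ennreal_leI flip: ennreal_numeral)
    next
      case 3
      then have "t powr (- 1 - s) * (1 - Re (char M t)) \<le> 2 * t powr (- 1 - s)"
        using mult_left_mono[OF le2, of "t powr (- 1 - s)"] by simp
      then show ?thesis
        using 3 by (simp add: ennreal_mult'[symmetric] ennreal_leI flip: ennreal_numeral)
    qed simp
  qed
  also have "\<dots> = 2 * (\<integral>\<^sup>+t. ennreal (indicator {0<..1} t * t powr (a - 1 - s)) \<partial>lborel)
      + 2 * (\<integral>\<^sup>+t. ennreal (indicator {1<..} t * t powr (- 1 - s)) \<partial>lborel)"
    by (subst nn_integral_add) (simp_all add: nn_integral_cmult)
  also have "\<dots> < \<infinity>"
    using nn_integral_powr_near_0[of "a - 1 - s"] nn_integral_powr_near_top[of "- 1 - s"] s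
    by (auto simp: ennreal_mult_less_top)
  finally have "(\<integral>\<^sup>+x. ennreal (\<bar>x\<bar> powr s) \<partial>M) < \<infinity>"
    using frac_moment_const_pos[of s] by (auto simp: ennreal_mult_less_top)
  then show ?thesis
    by (intro integrableI_nonneg) auto
qed

text \<open>Strict positivity is by contradiction: a vanishing moment would concentrate the law at 0
  and make the characteristic function 1 everywhere, but at t = 1 its modulus is at most exp(-cos(pi
  a/2)) < 1.\<close>

lemma (in real_distribution) one_sided_stable_moments:
  assumes a: "0 < a" "a < 1" and law: "stable_law a (cos (pi * a / 2) powr (1 / a)) 1 0 M"
  shows "AE x in M. 0 \<le> x"
    and "0 < s \<Longrightarrow> s < a \<Longrightarrow> integrable M (\<lambda>x. x powr s)"
    and "0 < s \<Longrightarrow> s < a \<Longrightarrow> 0 < (\<integral>x. x powr s \<partial>M)"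
proof -
  have char: "char M t = exp (- ((- \<i> * of_real t) powr of_real a))" for t
    using law by (simp add: stable_law_def stable_char_one_sided[OF a])
  show "AE x in M. 0 \<le> x"
    by (rule AE_nonneg_one_sided_char[OF a char])
  \<comment> \<open>Real \<open>powr\<close> sees a negative base only through its absolute value,
    so the two forms of the moment agree at every point, not just almost everywhere.\<close>
  have abs_powr: "\<bar>x\<bar> powr s = x powr s" for x s :: real
    by (simp add: powr_def ln_real_def)
  have bound: "1 - Re (char M t) \<le> 2 * t powr a" if "0 < t" for t
  proof -
    have "0 \<le> cos (pi * a / 2)"
      using cos_pi_half_mult_pos[OF a] by simp
    then have "0 \<le> Re ((- \<i> * of_real t) powr of_real a)"
      using Re_powr_ge[of a "- \<i> * of_real t"] a
      by (intro order_trans[OF mult_nonneg_nonneg[OF _ powr_ge_zero] Re_powr_ge]) auto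
    from one_minus_Re_exp_neg_le[OF this] show ?thesis
      using that by (simp add: char norm_powr_real_powr' norm_mult)
  qed
  show int: "integrable M (\<lambda>x. x powr s)" if "0 < s" "s < a" for s
    using integrable_abs_powr_if_char_bound[OF that bound] by (simp add: abs_powr)
  show "0 < (\<integral>x. x powr s \<partial>M)" if s: "0 < s" "s < a" for s
  proof (rule ccontr)
    assume "\<not> ?thesis"
    then have "(\<integral>x. x powr s \<partial>M) = 0"
      by (intro antisym Bochner_Integration.integral_nonneg) auto
    then have "AE x in M. x powr s = 0"
      using integral_nonneg_eq_0_iff_AE[OF int[OF s]] by simp
    then have z: "AE x in M. x = 0"
      by auto
    have "char M 1 = (CLINT x|M. 1)"
      unfolding char_def using z by (intro integral_cong_AE) (auto elim!: eventually_mono)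
    then have "exp (- ((- \<i>) powr of_real a)) = 1"
      using char[of 1] prob_space by simp
    then have "norm (exp (- ((- \<i> * 1) powr of_real a))) = 1" by simp
    moreover have "norm (exp (- ((- \<i> * 1) powr of_real a))) \<le> exp (- cos (pi * a / 2) * norm (1::complex) powr a)"
      using a by (intro norm_exp_neg_powr_le) auto
    moreover have "0 < cos (pi * a / 2)"
      by (rule cos_pi_half_mult_pos[OF a])
    ultimately show False by simp
  qed
qed

section \<open>The correlation function\<close>

text \<open>Convexity of S serves the mean value inequality, which puts the difference quotients
  below \<open>w\<close>; openness keeps a sequence tending to q eventually inside S. Dominated
  convergence then applies along sequences.\<close>

lemma has_field_derivative_integral_dominated:
  fixes f f' :: "real \<Rightarrow> 'a \<Rightarrow> real"
  assumes S: "open S" "convex S" "q \<in> S"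
    and int: "\<And>r. r \<in> S \<Longrightarrow> integrable M (f r)"
    and deriv: "\<And>r x. r \<in> S \<Longrightarrow> ((\<lambda>r. f r x) has_field_derivative f' r x) (at r)"
    and bound: "\<And>r x. r \<in> S \<Longrightarrow> \<bar>f' r x\<bar> \<le> w x"
    and w: "integrable M w"
    and meas: "f' q \<in> borel_measurable M"
  shows "((\<lambda>r. \<integral>x. f r x \<partial>M) has_field_derivative (\<integral>x. f' q x \<partial>M)) (at q)"
  unfolding has_field_derivative_iff tendsto_at_iff_sequentially
proof (intro allI impI)
  fix X :: "nat \<Rightarrow> real"
  assume X: "\<forall>i. X i \<in> UNIV - {q}" "X \<longlonglongrightarrow> q"
  obtain N where N: "\<And>n. N \<le> n \<Longrightarrow> X n \<in> S"
    using topological_tendstoD[OF X(2) S(1,3)] by (auto simp: eventually_sequentially)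
  define Y where "Y n = X (n + N)" for n
  have Y: "Y n \<in> S" "Y n \<noteq> q" "Y \<longlonglongrightarrow> q" for n
    using N X LIMSEQ_ignore_initial_segment[OF X(2), of N] by (auto simp: Y_def[abs_def])
  have "(\<lambda>n. \<integral>x. (f (Y n) x - f q x) / (Y n - q) \<partial>M) \<longlonglongrightarrow> (\<integral>x. f' q x \<partial>M)"
  proof (rule integral_dominated_convergence[OF meas _ w])
    show "(\<lambda>x. (f (Y n) x - f q x) / (Y n - q)) \<in> borel_measurable M" for n
      using borel_measurable_integrable[OF int] Y S(3) by (intro borel_measurable_divide borel_measurable_diff) auto
    show "AE x in M. (\<lambda>n. (f (Y n) x - f q x) / (Y n - q)) \<longlonglongrightarrow> f' q x"
      using deriv[OF S(3)] Y
      by (auto simp: has_field_derivative_iff tendsto_at_iff_sequentially comp_def)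
    show "AE x in M. norm ((f (Y n) x - f q x) / (Y n - q)) \<le> w x" for n
    proof (intro always_eventually allI)
      fix x
      have "norm (f (Y n) x - f q x) \<le> w x * norm (Y n - q)"
        using S(2)
        by (rule field_differentiable_bound[where f' = "\<lambda>r. f' r x"])
           (use deriv bound Y S(3) in \<open>auto intro: has_field_derivative_at_within\<close>)
      then show "norm ((f (Y n) x - f q x) / (Y n - q)) \<le> w x"
        using Y(2)[of n] by (simp add: divide_simps)
    qed
  qed
  also have "(\<lambda>n. \<integral>x. (f (Y n) x - f q x) / (Y n - q) \<partial>M)
      = (\<lambda>n. ((\<integral>x. f (Y n) x \<partial>M) - (\<integral>x. f q x \<partial>M)) / (Y n - q))"
    using int Y(1) S(3) by (simp add: Bochner_Integration.integral_diff)
  finally have "(\<lambda>n. ((\<integral>x. f (X (n + N)) x \<partial>M) - (\<integral>x. f q x \<partial>M)) / (X (n + N) - q)) \<longlonglongrightarrow> (\<integral>x. f' q x \<partial>M)"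
    unfolding Y_def .
  then show "((\<lambda>r. ((\<integral>x. f r x \<partial>M) - (\<integral>x. f q x \<partial>M)) / (r - q)) \<circ> X) \<longlonglongrightarrow> (\<integral>x. f' q x \<partial>M)"
    unfolding comp_def by (rule LIMSEQ_offset)
qed

section \<open>Signed powers\<close>

lemma signed_pow_measurable [measurable]: "(\<lambda>x. signed_pow x p) \<in> borel_measurable borel"
  unfolding signed_pow_def by measurable

lemma abs_signed_pow: "\<bar>signed_pow x p\<bar> = \<bar>x\<bar> powr p"
  by (simp add: signed_pow_def abs_mult sgn_real_def)

lemma signed_pow_mult: "signed_pow (x * y) p = signed_pow x p * signed_pow y p"
  by (simp add: signed_pow_def abs_mult sgn_mult powr_mult)

lemma signed_pow_minus: "signed_pow (- x) p = - signed_pow x p"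
  by (simp add: signed_pow_def sgn_minus)

lemma powr_le_one_plus:
  fixes x :: real
  assumes "0 \<le> x" "0 \<le> p" "p \<le> 1"
  shows "x powr p \<le> 1 + x"
proof (cases "x \<le> 1")
  case True
  then show ?thesis using assms powr_le1[of p x] by simp
next
  case False
  then show ?thesis using powr_mono[of p 1 x] assms by simp
qed

text \<open>The slope p |x|^(p-1) decreases in |x| for p <= 1, so on [-m, m] it is at least p
  m^(p-1). The mean value theorem is used on each side of 0 separately, because the slope may be
  infinite at 0, and oddness reduces the negative side to the positive one.\<close>

lemma signed_pow_diff_ge:
  assumes p: "0 < p" "p \<le> 1" and xy: "x \<le> y" "\<bar>x\<bar> \<le> m" "\<bar>y\<bar> \<le> m"
  shows "p * m powr (p - 1) * (y - x) \<le> signed_pow y p - signed_pow x p"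
proof -
  have pos: "p * m powr (p - 1) * (v - u) \<le> signed_pow v p - signed_pow u p"
    if uv: "0 \<le> u" "u \<le> v" "v \<le> m" for u v
  proof (cases "u = v")
    case False
    have deriv: "((\<lambda>x. x powr p) has_real_derivative p * z powr (p - 1)) (at z)" if "u < z" for z
      using that uv by (auto intro!: derivative_eq_intros)
    have "\<exists>l z. u < z \<and> z < v \<and> ((\<lambda>x. x powr p) has_real_derivative l) (at z) \<and> v powr p - u powr p = (v - u) * l"
    proof (rule MVT)
      show "u < v" using uv False by simp
      show "continuous_on {u..v} (\<lambda>x. x powr p)"
        using p uv by (intro continuous_on_powr' continuous_intros) auto
      show "(\<lambda>x. x powr p) differentiable (at z)" if "u < z" "z < v" for z
        using deriv[OF that(1)] real_differentiable_def by blast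
    qed
    then obtain z where z: "u < z" "z < v" "v powr p - u powr p = (v - u) * (p * z powr (p - 1))"
      using DERIV_unique[OF deriv] by metis
    have "m powr (p - 1) \<le> z powr (p - 1)"
      using z uv p by (intro powr_mono2') auto
    then have "(v - u) * (p * m powr (p - 1)) \<le> (v - u) * (p * z powr (p - 1))"
      using uv p by (intro mult_left_mono) auto
    moreover have "signed_pow v p = v powr p" "signed_pow u p = u powr p"
      using uv False by (auto simp: signed_pow_def sgn_if)
    ultimately show ?thesis using z(3) by (simp add: mult_ac)
  qed simp
  consider "0 \<le> x" | "y \<le> 0" | "x < 0" "0 < y" using xy by linarith
  then show ?thesis
  proof cases
    case 1
    then show ?thesis using pos[of x y] xy by simp
  next
    case 2
    then show ?thesis using pos[of "-y" "-x"] xy by (simp add: signed_pow_minus)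
  next
    case 3
    have "p * m powr (p - 1) * y \<le> signed_pow y p" "p * m powr (p - 1) * (- x) \<le> - signed_pow x p"
      using pos[of 0 y] pos[of 0 "- x"] 3 xy by (simp_all add: signed_pow_minus signed_pow_def[of 0])
    then show ?thesis by (simp add: right_diff_distrib)
  qed
qed

section \<open>The bivariate normal density, its score and integrable envelopes\<close>

lemma integrable_gaussian_prod:
  assumes "0 < c"
  shows "integrable lborel (\<lambda>z::real\<times>real. exp (- ((fst z)\<^sup>2 + (snd z)\<^sup>2) * c))"
proof -
  have i: "integrable lborel (\<lambda>x::real. exp (- x\<^sup>2 * c))"
  proof -
    have "integrable lborel (\<lambda>x. sqrt (2 * pi * (sqrt (1 / (2 * c)))\<^sup>2) * normal_density 0 (sqrt (1 / (2 * c))) x)"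
      using assms by (intro integrable_mult_right integrable_normal_density) auto
    then show ?thesis
      using assms by (simp add: normal_density_def real_sqrt_divide power_divide mult.commute)
  qed
  have "integrable (lborel \<Otimes>\<^sub>M lborel) (\<lambda>z::real\<times>real. exp (- (fst z)\<^sup>2 * c) * exp (- (snd z)\<^sup>2 * c))"
    by (rule lborel_pair.Fubini_integrable) (use i in \<open>auto simp: abs_mult\<close>)
  then show ?thesis
    by (simp add: lborel_prod exp_add[symmetric] algebra_simps)
qed

text \<open>Half of the decay exp(-s/4) pays for the polynomial. The number 24 = 3 * 8 is chosen so
  that the cube of exp(s/24) is exp(s/8).\<close>

lemma one_plus_cube_le_exp:
  fixes s :: real
  assumes "0 \<le> s"
  shows "(1 + s) ^ 3 * exp (- s / 4) \<le> 24 ^ 3 * exp (- s / 8)"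
proof -
  have "1 + s \<le> 24 * exp (s / 24)"
    using exp_ge_add_one_self[of "s / 24"] assms by (simp add: field_simps)
  then have "(1 + s) ^ 3 \<le> (24 * exp (s / 24)) ^ 3"
    using assms by (intro power_mono) auto
  also have "\<dots> = 24 ^ 3 * exp (s / 8)"
    by (simp add: power_mult_distrib exp_of_nat_mult[symmetric])
  finally have "(1 + s) ^ 3 * exp (- s / 4) \<le> 24 ^ 3 * exp (s / 8) * exp (- s / 4)"
    by (intro mult_right_mono) auto
  also have "\<dots> = 24 ^ 3 * exp (- s / 8)"
    by (simp add: mult.assoc exp_add[symmetric])
  finally show ?thesis .
qed

lemma borel_measurable_fst_snd [measurable (raw)]:
  fixes f :: "'a \<Rightarrow> real \<times> real"
  assumes "f \<in> borel_measurable M"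
  shows "(\<lambda>x. fst (f x)) \<in> borel_measurable M" "(\<lambda>x. snd (f x)) \<in> borel_measurable M"
  using assms unfolding borel_prod[symmetric] by (auto intro: measurable_compose)

lemma bivar_normal_density_pos: "\<bar>r\<bar> < 1 \<Longrightarrow> 0 < bivar_normal_density r z"
  by (simp add: bivar_normal_density_def case_prod_beta abs_square_less_1)

lemma bivar_normal_density_nonneg: "\<bar>r\<bar> < 1 \<Longrightarrow> 0 \<le> bivar_normal_density r z"
  by (simp add: bivar_normal_density_pos less_imp_le)

lemma bivar_normal_density_measurable [measurable]:
  "bivar_normal_density r \<in> borel_measurable borel"
  unfolding bivar_normal_density_def case_prod_beta by measurable

lemma sets_bivar_normal [simp, measurable_cong]: "sets (bivar_normal r) = sets borel"
  by (simp add: bivar_normal_def)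

lemma space_bivar_normal [simp]: "space (bivar_normal r) = UNIV"
  by (simp add: bivar_normal_def)

text \<open>The inverse covariance matrix has eigenvalues 1/(1+r) and 1/(1-r), both above 1/2; the
  sum of squares in the proof expresses this without diagonalizing. The resulting exponent is free
  of r, so it can dominate all correlations at once.\<close>

lemma bivar_normal_density_le:
  assumes r: "\<bar>r\<bar> < 1"
  shows "bivar_normal_density r z \<le> 1 / (1 - r\<^sup>2) * exp (- ((fst z)\<^sup>2 + (snd z)\<^sup>2) / 4)"
proof -
  obtain x y where z: "z = (x, y)" by fastforce
  have d: "0 < 1 - r\<^sup>2" "1 - r\<^sup>2 \<le> 1"
    using r by (simp_all add: abs_square_less_1)
  have "2 * (x\<^sup>2 - 2 * r * x * y + y\<^sup>2) - (1 - r\<^sup>2) * (x\<^sup>2 + y\<^sup>2) = (x - r * y)\<^sup>2 + (y - r * x)\<^sup>2"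
    by (simp add: power2_eq_square algebra_simps)
  then have "(1 - r\<^sup>2) * (x\<^sup>2 + y\<^sup>2) \<le> 2 * (x\<^sup>2 - 2 * r * x * y + y\<^sup>2)"
    by (smt (verit) zero_le_power2)
  then have "- (x\<^sup>2 - 2 * r * x * y + y\<^sup>2) / (2 * (1 - r\<^sup>2)) \<le> - (x\<^sup>2 + y\<^sup>2) / 4"
    using d by (simp add: field_simps)
  moreover have "1 / (2 * pi * sqrt (1 - r\<^sup>2)) \<le> 1 / (1 - r\<^sup>2)"
  proof (intro divide_left_mono)
    have "(1 - r\<^sup>2) \<le> sqrt (1 - r\<^sup>2)"
      using d by (intro real_le_rsqrt) (simp add: power2_eq_square mult_left_le)
    also have "\<dots> \<le> 2 * pi * sqrt (1 - r\<^sup>2)"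
      using d pi_ge_two by simp
    finally show "1 - r\<^sup>2 \<le> 2 * pi * sqrt (1 - r\<^sup>2)" .
  qed (use d in auto)
  ultimately show ?thesis
    unfolding bivar_normal_density_def z prod.case fst_conv snd_conv
    using d by (intro mult_mono) auto
qed

text \<open>The derivative of the logarithm of the density with respect to the correlation.\<close>

definition bivar_score :: "real \<Rightarrow> real \<times> real \<Rightarrow> real" where
  "bivar_score r = (\<lambda>(x, y).
     r / (1 - r\<^sup>2) + (x * y * (1 - r\<^sup>2) - r * (x\<^sup>2 - 2 * r * x * y + y\<^sup>2)) / (1 - r\<^sup>2)\<^sup>2)"

lemma has_field_derivative_bivar_normal_density:
  assumes "\<bar>r\<bar> < 1"
  shows "((\<lambda>r. bivar_normal_density r z) has_field_derivative bivar_normal_density r z * bivar_score r z) (at r)"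
proof -
  obtain x y where z: "z = (x, y)" by fastforce
  have d: "0 < 1 - r\<^sup>2"
    using assms by (simp add: abs_square_less_1)
  define w where "w = sqrt (1 - r\<^sup>2)"
  have w: "0 < w" "w\<^sup>2 = 1 - r\<^sup>2" using d by (simp_all add: w_def)
  have 1: "((\<lambda>r. 1 / (2 * pi * sqrt (1 - r\<^sup>2))) has_field_derivative
      1 / (2 * pi * sqrt (1 - r\<^sup>2)) * (r / (1 - r\<^sup>2))) (at r)"
    using d by (auto intro!: derivative_eq_intros simp: w_def[symmetric] w(2)[symmetric])
      (use w in \<open>simp add: field_simps power2_eq_square\<close>)
  have 2: "((\<lambda>r. - (x\<^sup>2 - 2 * r * x * y + y\<^sup>2) / (2 * (1 - r\<^sup>2))) has_field_derivative
      (x * y * (1 - r\<^sup>2) - r * (x\<^sup>2 - 2 * r * x * y + y\<^sup>2)) / (1 - r\<^sup>2)\<^sup>2) (at r)"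
    using d by (auto intro!: derivative_eq_intros simp: divide_simps) (simp add: power2_eq_square algebra_simps)
  have alg: "c * a * u + u * v * c = c * u * (a + v)" for a c u v :: real
    by (simp add: algebra_simps)
  show ?thesis
    unfolding bivar_normal_density_def bivar_score_def z prod.case
    by (rule DERIV_cong[OF DERIV_mult[OF 1 DERIV_fun_exp[OF 2]]]) (rule alg)
qed

text \<open>With s = x^2 + y^2, the two terms of the numerator are at most s/2 and 2 s, rounded up
  to 3 s in total. The parameter \<open>e\<close> measures the distance of r from -1 and 1 and makes
  the bound uniform; \<open>e <= 1\<close> lets 1/e^2 bound the first summand too.\<close>

lemma abs_bivar_score_le:
  assumes r: "\<bar>r\<bar> < 1" and e: "0 < e" "e \<le> 1 - r\<^sup>2" 
  shows "\<bar>bivar_score r z\<bar> \<le> 3 * (1 + ((fst z)\<^sup>2 + (snd z)\<^sup>2)) / e\<^sup>2"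
proof -
  obtain x y where z: "z = (x, y)" by fastforce
  let ?s = "x\<^sup>2 + y\<^sup>2"
  have r2: "0 \<le> 1 - r\<^sup>2" "1 - r\<^sup>2 \<le> 1" using e by auto
  have xy: "\<bar>x * y\<bar> \<le> ?s / 2"
    using sum_squares_bound[of "\<bar>x\<bar>" "\<bar>y\<bar>"] by (simp add: abs_mult)
  have "\<bar>2 * (r * (x * y))\<bar> \<le> ?s"
    using mult_mono[of "\<bar>r\<bar>" 1 "\<bar>x * y\<bar>" "?s / 2"] r xy by (simp add: abs_mult)
  then have N: "\<bar>x\<^sup>2 - 2 * r * x * y + y\<^sup>2\<bar> \<le> 2 * ?s"
    by (simp add: mult.assoc abs_if split: if_splits)
  have "\<bar>x * y * (1 - r\<^sup>2)\<bar> \<le> ?s / 2 * 1"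
    unfolding abs_mult[of "x * y"] using xy r2 by (intro mult_mono) auto
  moreover have "\<bar>r * (x\<^sup>2 - 2 * r * x * y + y\<^sup>2)\<bar> \<le> 1 * (2 * ?s)"
    unfolding abs_mult[of r] using N r by (intro mult_mono) auto
  ultimately have num: "\<bar>x * y * (1 - r\<^sup>2) - r * (x\<^sup>2 - 2 * r * x * y + y\<^sup>2)\<bar> \<le> 3 * ?s"
    using abs_triangle_ineq4[of "x * y * (1 - r\<^sup>2)" "r * (x\<^sup>2 - 2 * r * x * y + y\<^sup>2)"] sum_power2_ge_zero[of x y]
    by linarith
  have "\<bar>(x * y * (1 - r\<^sup>2) - r * (x\<^sup>2 - 2 * r * x * y + y\<^sup>2)) / (1 - r\<^sup>2)\<^sup>2\<bar> \<le> 3 * ?s / e\<^sup>2"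
    unfolding abs_divide using num e by (intro frac_le) (auto intro: power_mono)
  moreover have "\<bar>r / (1 - r\<^sup>2)\<bar> \<le> 1 / e\<^sup>2"
    unfolding abs_divide
  proof (intro frac_le)
    show "e\<^sup>2 \<le> \<bar>1 - r\<^sup>2\<bar>"
      using mult_left_le[of e e] e r2 unfolding power2_eq_square[of e] by linarith
  qed (use r e in auto)
  ultimately have "\<bar>bivar_score r z\<bar> \<le> 1 / e\<^sup>2 + 3 * ?s / e\<^sup>2"
    unfolding bivar_score_def z prod.case by (rule order_trans[OF abs_triangle_ineq add_mono, rotated])
  also have "\<dots> \<le> 3 * (1 + ?s) / e\<^sup>2"
    using e by (simp add: field_simps)
  finally show ?thesis by (simp add: z)
qed

lemma powr_abs_mult_le:
  fixes x y :: real
  assumes "0 \<le> p" "p \<le> 1"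
  shows "\<bar>x * y\<bar> powr p \<le> 1 + (x\<^sup>2 + y\<^sup>2)"
proof -
  define t where "t = \<bar>x * y\<bar>"
  have "t \<le> (x\<^sup>2 + y\<^sup>2) / 2"
    using sum_squares_bound[of "\<bar>x\<bar>" "\<bar>y\<bar>"] by (simp add: t_def abs_mult)
  also have "\<dots> \<le> x\<^sup>2 + y\<^sup>2"
    by simp
  finally have "1 + t \<le> 1 + (x\<^sup>2 + y\<^sup>2)"
    by (rule add_left_mono)
  moreover have "t powr p \<le> 1 + t"
    by (intro powr_le_one_plus assms) (simp add: t_def)
  ultimately show ?thesis
    unfolding t_def[symmetric] by (rule order_trans[rotated])
qed

text \<open>A common envelope: under the derivative, the score takes one factor 1 + |z|^2 and the
  signed power fits into the other two.\<close>

lemma integrable_cube_gaussian: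
  "integrable lborel (\<lambda>z::real\<times>real. (1 + ((fst z)\<^sup>2 + (snd z)\<^sup>2)) ^ 3 * exp (- ((fst z)\<^sup>2 + (snd z)\<^sup>2) / 4))"
proof (rule Bochner_Integration.integrable_bound)
  show "integrable lborel (\<lambda>z::real\<times>real. 24 ^ 3 * exp (- ((fst z)\<^sup>2 + (snd z)\<^sup>2) * (1 / 8)))"
    by (intro integrable_mult_right integrable_gaussian_prod) auto
  show "AE z::real\<times>real in lborel. norm ((1 + ((fst z)\<^sup>2 + (snd z)\<^sup>2)) ^ 3 * exp (- ((fst z)\<^sup>2 + (snd z)\<^sup>2) / 4))
     \<le> norm (24 ^ 3 * exp (- ((fst z)\<^sup>2 + (snd z)\<^sup>2) * (1 / 8)))"
  proof (intro always_eventually allI)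
    fix z :: "real \<times> real"
    let ?s = "(fst z)\<^sup>2 + (snd z)\<^sup>2"
    have "norm ((1 + ?s) ^ 3 * exp (- ?s / 4)) = (1 + ?s) ^ 3 * exp (- ?s / 4)"
      by simp
    also have "\<dots> \<le> 24 ^ 3 * exp (- ?s / 8)"
      by (rule one_plus_cube_le_exp) simp
    also have "\<dots> = norm (24 ^ 3 * exp (- ?s * (1 / 8)))"
      by simp
    finally show "norm ((1 + ?s) ^ 3 * exp (- ?s / 4)) \<le> norm (24 ^ 3 * exp (- ?s * (1 / 8)))" .
  qed
qed measurable

lemma integrable_bivar_normal:
  assumes r: "\<bar>r\<bar> < 1" and g: "g \<in> borel_measurable borel"
    and le: "\<And>z. \<bar>g z\<bar> \<le> (1 + ((fst z)\<^sup>2 + (snd z)\<^sup>2)) ^ 3"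
  shows "integrable lborel (\<lambda>z. bivar_normal_density r z * g z)" and "integrable (bivar_normal r) g"
proof -
  show 1: "integrable lborel (\<lambda>z. bivar_normal_density r z * g z)"
  proof (rule Bochner_Integration.integrable_bound)
    show "integrable lborel (\<lambda>z::real\<times>real. 1 / (1 - r\<^sup>2) * ((1 + ((fst z)\<^sup>2 + (snd z)\<^sup>2)) ^ 3 * exp (- ((fst z)\<^sup>2 + (snd z)\<^sup>2) / 4)))"
      by (intro integrable_mult_right integrable_cube_gaussian)
    show "AE z in lborel. norm (bivar_normal_density r z * g z) \<le>
        norm (1 / (1 - r\<^sup>2) * ((1 + ((fst z)\<^sup>2 + (snd z)\<^sup>2)) ^ 3 * exp (- ((fst z)\<^sup>2 + (snd z)\<^sup>2) / 4)))"
    proof (intro always_eventually allI)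
      fix z :: "real \<times> real"
      have "norm (bivar_normal_density r z * g z) \<le>
         1 / (1 - r\<^sup>2) * exp (- ((fst z)\<^sup>2 + (snd z)\<^sup>2) / 4) * (1 + ((fst z)\<^sup>2 + (snd z)\<^sup>2)) ^ 3"
        unfolding real_norm_def abs_mult
        using bivar_normal_density_le[OF r, of z] bivar_normal_density_nonneg[OF r, of z] le[of z]
        by (intro mult_mono) auto
      also have "\<dots> \<le> norm (1 / (1 - r\<^sup>2) * ((1 + ((fst z)\<^sup>2 + (snd z)\<^sup>2)) ^ 3 * exp (- ((fst z)\<^sup>2 + (snd z)\<^sup>2) / 4)))"
        unfolding real_norm_def by (rule order_trans[OF eq_refl abs_ge_self]) (simp only: mult_ac)
      finally show "norm (bivar_normal_density r z * g z) \<le>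
        norm (1 / (1 - r\<^sup>2) * ((1 + ((fst z)\<^sup>2 + (snd z)\<^sup>2)) ^ 3 * exp (- ((fst z)\<^sup>2 + (snd z)\<^sup>2) / 4)))" .
    qed
  qed (use g in measurable)
  then show "integrable (bivar_normal r) g"
    unfolding bivar_normal_def using g bivar_normal_density_nonneg[OF r]
    by (subst integrable_density) auto
qed

lemma le_one_plus_power3:
  fixes s :: real
  assumes "0 \<le> s"
  shows "1 + s \<le> (1 + s) ^ 3" "1 + s \<le> (1 + s) ^ 2"
  using assms self_le_power[of "1 + s" 3] self_le_power[of "1 + s" 2] by auto

lemma signed_pow_prod_measurable [measurable]:
  "(\<lambda>z. signed_pow (fst z * snd z) p) \<in> borel_measurable (borel :: (real \<times> real) measure)"
  by (rule measurable_compose[OF _ signed_pow_measurable]) measurable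

lemma integrable_signed_pow_bivar_normal:
  assumes r: "\<bar>r\<bar> < 1" and p: "0 \<le> p" "p \<le> 1"
  shows "integrable (bivar_normal r) (\<lambda>z. signed_pow (fst z * snd z) p)"
    and "integrable lborel (\<lambda>z. bivar_normal_density r z * signed_pow (fst z * snd z) p)"
proof -
  have "\<bar>signed_pow (fst z * snd z) p\<bar> \<le> (1 + ((fst z)\<^sup>2 + (snd z)\<^sup>2)) ^ 3" for z
    unfolding abs_signed_pow
    using powr_abs_mult_le[OF p, of "fst z" "snd z"] le_one_plus_power3(1)[of "(fst z)\<^sup>2 + (snd z)\<^sup>2"] by auto
  note integrable_bivar_normal[OF r signed_pow_prod_measurable this]
  then show "integrable (bivar_normal r) (\<lambda>z. signed_pow (fst z * snd z) p)"
    and "integrable lborel (\<lambda>z. bivar_normal_density r z * signed_pow (fst z * snd z) p)"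
    by blast+
qed

lemma f_fun_eq_lborel:
  "\<bar>r\<bar> < 1 \<Longrightarrow> f_fun p r = (\<integral>z. bivar_normal_density r z * signed_pow (fst z * snd z) p \<partial>lborel)"
  unfolding f_fun_def bivar_normal_def
  by (subst integral_density) (auto simp: bivar_normal_density_nonneg)

text \<open>The parameter sits in the density, so the derivative never falls on the signed power,
  which is not smooth at 0.\<close>

lemma f_fun_differentiable:
  assumes q: "\<bar>q\<bar> < 1" and p: "0 \<le> p" "p \<le> 1"
  shows "f_fun p field_differentiable (at q)"
proof -
  obtain R where R: "\<bar>q\<bar> < R" "R < 1" using dense[OF q] by blast
  define e where "e = 1 - R\<^sup>2"
  have e: "0 < e" using R by (simp add: e_def abs_square_less_1)
  \<comment> \<open>For |r| < R one has 1 - r^2 >= e. The density contributes 1/e and the score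
    3/e^2, hence 3/e^3.\<close>
  define w :: "real \<times> real \<Rightarrow> real" where
    "w z = 3 / e ^ 3 * ((1 + ((fst z)\<^sup>2 + (snd z)\<^sup>2)) ^ 3 * exp (- ((fst z)\<^sup>2 + (snd z)\<^sup>2) / 4))" for z
  have bound: "\<bar>bivar_normal_density r z * bivar_score r z * signed_pow (fst z * snd z) p\<bar> \<le> w z"
    if r: "r \<in> {-R<..<R}" for r z
  proof -
    let ?s = "(fst z)\<^sup>2 + (snd z)\<^sup>2"
    have s: "0 \<le> ?s" by simp
    have r1: "\<bar>r\<bar> < 1" using r R by auto
    have er: "e \<le> 1 - r\<^sup>2"
      using r by (auto simp: e_def abs_le_square_iff[symmetric])
    have "bivar_normal_density r z \<le> 1 / (1 - r\<^sup>2) * exp (- ?s / 4)"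
      by (rule bivar_normal_density_le[OF r1])
    also have "\<dots> \<le> 1 / e * exp (- ?s / 4)"
      using e er by (intro mult_right_mono divide_left_mono) auto
    finally have "\<bar>bivar_normal_density r z\<bar> \<le> 1 / e * exp (- ?s / 4)"
      by (simp add: bivar_normal_density_nonneg[OF r1])
    moreover have "\<bar>bivar_score r z\<bar> \<le> 3 * (1 + ?s) / e\<^sup>2"
      by (rule abs_bivar_score_le[OF r1 e er])
    moreover have "\<bar>signed_pow (fst z * snd z) p\<bar> \<le> (1 + ?s) ^ 2"
      unfolding abs_signed_pow
      using powr_abs_mult_le[OF p, of "fst z" "snd z"] le_one_plus_power3(2)[OF s] by linarith
    ultimately have "\<bar>bivar_normal_density r z * bivar_score r z * signed_pow (fst z * snd z) p\<bar>
        \<le> 1 / e * exp (- ?s / 4) * (3 * (1 + ?s) / e\<^sup>2) * (1 + ?s) ^ 2"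
      unfolding abs_mult using e s by (intro mult_mono mult_nonneg_nonneg divide_nonneg_nonneg) auto
    also have "\<dots> = w z"
      using e by (simp add: w_def power2_eq_square power3_eq_cube mult_ac)
    finally show ?thesis .
  qed
  have "((\<lambda>r. \<integral>z. bivar_normal_density r z * signed_pow (fst z * snd z) p \<partial>lborel) has_field_derivative
      (\<integral>z. bivar_normal_density q z * bivar_score q z * signed_pow (fst z * snd z) p \<partial>lborel)) (at q)"
  proof (rule has_field_derivative_integral_dominated[where S = "{-R<..<R}" and w = w])
    fix r z assume "r \<in> {-R<..<R}"
    then have "\<bar>r\<bar> < 1" using R by auto
    then show "integrable lborel (\<lambda>z. bivar_normal_density r z * signed_pow (fst z * snd z) p)"
      by (rule integrable_signed_pow_bivar_normal(2)[OF _ p])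
    show "((\<lambda>r. bivar_normal_density r z * signed_pow (fst z * snd z) p) has_field_derivative
       bivar_normal_density r z * bivar_score r z * signed_pow (fst z * snd z) p) (at r)"
      by (rule DERIV_cmult_right[OF has_field_derivative_bivar_normal_density]) fact
  next
    show "integrable lborel w"
      unfolding w_def by (intro integrable_mult_right integrable_cube_gaussian)
    show "(\<lambda>z. bivar_normal_density q z * bivar_score q z * signed_pow (fst z * snd z) p) \<in> borel_measurable lborel"
      unfolding bivar_score_def case_prod_beta by measurable
  qed (use R bound in auto)
  \<comment> \<open>The Lebesgue form of f is available only for |r| < 1, so the derivative is
    transferred inside this open interval.\<close>
  then have "(f_fun p has_field_derivative
      (\<integral>z. bivar_normal_density q z * bivar_score q z * signed_pow (fst z * snd z) p \<partial>lborel)) (at q)"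
    by (rule has_field_derivative_transform_within_open[where S = "{-1<..<1}"])
       (use q in \<open>auto simp: f_fun_eq_lborel\<close>)
  then show ?thesis
    unfolding field_differentiable_def by blast
qed

text \<open>The linear map has Jacobian 2ab. It is split into two one-dimensional affine
  substitutions, y = x - 2bv at fixed x and then x = bv + au at fixed v, with Tonelli in
  between.\<close>

lemma nn_integral_rotate_scale:
  fixes H :: "real \<times> real \<Rightarrow> ennreal" and a b :: real
  assumes [measurable]: "H \<in> borel_measurable borel" and ab: "0 < a" "0 < b"
  shows "(\<integral>\<^sup>+z. H z \<partial>lborel) = ennreal (2 * a * b) * (\<integral>\<^sup>+z. H (a * fst z + b * snd z, a * fst z - b * snd z) \<partial>lborel)"
proof -
  have [measurable]: "H \<in> borel_measurable (borel \<Otimes>\<^sub>M borel)"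
    by (simp add: borel_prod)
  have "(\<integral>\<^sup>+z. H z \<partial>lborel) = (\<integral>\<^sup>+x. \<integral>\<^sup>+y. H (x, y) \<partial>lborel \<partial>lborel)"
    by (subst lborel_prod[symmetric]) (simp add: lborel.nn_integral_fst[symmetric])
  also have "\<dots> = (\<integral>\<^sup>+x. ennreal (2 * b) * (\<integral>\<^sup>+v. H (x, x - 2 * b * v) \<partial>lborel) \<partial>lborel)"
  proof (intro nn_integral_cong)
    fix x :: real
    have "(\<integral>\<^sup>+y. H (x, y) \<partial>lborel) = ennreal \<bar>- 2 * b\<bar> * (\<integral>\<^sup>+v. H (x, x + (- 2 * b) * v) \<partial>lborel)"
      using ab by (intro nn_integral_real_affine) auto
    then show "(\<integral>\<^sup>+y. H (x, y) \<partial>lborel) = ennreal (2 * b) * (\<integral>\<^sup>+v. H (x, x - 2 * b * v) \<partial>lborel)"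
      using ab by simp
  qed
  also have "\<dots> = ennreal (2 * b) * (\<integral>\<^sup>+x. \<integral>\<^sup>+v. H (x, x - 2 * b * v) \<partial>lborel \<partial>lborel)"
    by (intro nn_integral_cmult) measurable
  also have "(\<integral>\<^sup>+x. \<integral>\<^sup>+v. H (x, x - 2 * b * v) \<partial>lborel \<partial>lborel) = (\<integral>\<^sup>+v. \<integral>\<^sup>+x. H (x, x - 2 * b * v) \<partial>lborel \<partial>lborel)"
    by (intro lborel_pair.Fubini') measurable
  also have "\<dots> = (\<integral>\<^sup>+v. ennreal a * (\<integral>\<^sup>+u. H (a * u + b * v, a * u - b * v) \<partial>lborel) \<partial>lborel)"
  proof (intro nn_integral_cong)
    fix v :: real
    have "(\<integral>\<^sup>+x. H (x, x - 2 * b * v) \<partial>lborel) = ennreal \<bar>a\<bar> * (\<integral>\<^sup>+u. H (b * v + a * u, b * v + a * u - 2 * b * v) \<partial>lborel)"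
      using ab by (intro nn_integral_real_affine) auto
    then show "(\<integral>\<^sup>+x. H (x, x - 2 * b * v) \<partial>lborel) = ennreal a * (\<integral>\<^sup>+u. H (a * u + b * v, a * u - b * v) \<partial>lborel)"
      using ab by (simp add: algebra_simps)
  qed
  also have "\<dots> = ennreal a * (\<integral>\<^sup>+v. \<integral>\<^sup>+u. H (a * u + b * v, a * u - b * v) \<partial>lborel \<partial>lborel)"
    by (intro nn_integral_cmult) measurable
  also have "(\<integral>\<^sup>+v. \<integral>\<^sup>+u. H (a * u + b * v, a * u - b * v) \<partial>lborel \<partial>lborel)
      = (\<integral>\<^sup>+u. \<integral>\<^sup>+v. H (a * u + b * v, a * u - b * v) \<partial>lborel \<partial>lborel)"
    by (intro lborel_pair.Fubini') measurable
  also have "\<dots> = (\<integral>\<^sup>+z. H (a * fst z + b * snd z, a * fst z - b * snd z) \<partial>lborel)"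
    unfolding lborel_prod[symmetric] by (simp add: lborel.nn_integral_fst[symmetric])
  also have "ennreal (2 * b) * (ennreal a * (\<integral>\<^sup>+z. H (a * fst z + b * snd z, a * fst z - b * snd z) \<partial>lborel))
      = ennreal (2 * a * b) * (\<integral>\<^sup>+z. H (a * fst z + b * snd z, a * fst z - b * snd z) \<partial>lborel)"
  proof -
    have "ennreal (2 * a * b) = ennreal (2 * b) * ennreal a"
      using ab by (subst ennreal_mult[symmetric]) (auto simp: mult.commute)
    then show ?thesis by (simp only: mult.assoc)
  qed
  finally show ?thesis .
qed

text \<open>With a^2 = (1+r)/2 and b^2 = (1-r)/2, the vector (aU + bV, aU - bV) has variances a^2 +
  b^2 = 1 and covariance a^2 - b^2 = r. On densities the quadratic form becomes (1 - r^2)(u^2 +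
  v^2), and the Jacobian 2ab = sqrt(1 - r^2) cancels the normalizing factor.\<close>

lemma bivar_normal_eq_distr:
  assumes r: "\<bar>r\<bar> < 1"
  shows "bivar_normal r = distr (bivar_normal 0) borel
    (\<lambda>z. (sqrt ((1 + r) / 2) * fst z + sqrt ((1 - r) / 2) * snd z, sqrt ((1 + r) / 2) * fst z - sqrt ((1 - r) / 2) * snd z))"
    (is "_ = distr _ _ ?T")
proof (rule measure_eqI)
  define a where "a = sqrt ((1 + r) / 2)"
  define b where "b = sqrt ((1 - r) / 2)"
  have ab: "0 < a" "0 < b" "a\<^sup>2 = (1 + r) / 2" "b\<^sup>2 = (1 - r) / 2"
    using r by (auto simp: a_def b_def)
  have T: "?T = (\<lambda>z. (a * fst z + b * snd z, a * fst z - b * snd z))"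
    by (simp add: a_def b_def)
  have T_meas [measurable]: "(\<lambda>z. (a * fst z + b * snd z, a * fst z - b * snd z)) \<in> borel_measurable (borel :: (real \<times> real) measure)"
    unfolding borel_prod[symmetric] by measurable
  have d: "0 < 1 - r\<^sup>2" using r by (simp add: abs_square_less_1)
  have "(2 * a * b)\<^sup>2 = 1 - r\<^sup>2"
    unfolding power_mult_distrib ab by (simp add: power2_eq_square field_simps)
  then have tab: "2 * a * b = sqrt (1 - r\<^sup>2)"
    using ab by (simp add: real_sqrt_unique)
  have dens: "sqrt (1 - r\<^sup>2) * bivar_normal_density r (a * u + b * v, a * u - b * v) = bivar_normal_density 0 (u, v)" for u v
  proof -
    have "(a * u + b * v)\<^sup>2 - 2 * r * (a * u + b * v) * (a * u - b * v) + (a * u - b * v)\<^sup>2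
        = 2 * a\<^sup>2 * u\<^sup>2 * (1 - r) + 2 * b\<^sup>2 * v\<^sup>2 * (1 + r)"
      by (simp add: power2_eq_square algebra_simps)
    also have "\<dots> = (1 - r\<^sup>2) * (u\<^sup>2 + v\<^sup>2)"
      unfolding ab by (simp add: power2_eq_square field_simps)
    finally have quad: "(a * u + b * v)\<^sup>2 - 2 * r * (a * u + b * v) * (a * u - b * v) + (a * u - b * v)\<^sup>2
        = (1 - r\<^sup>2) * (u\<^sup>2 + v\<^sup>2)" .
    have frac: "- (D * w) / (2 * D) = - w / 2" if "0 < D" for D w :: real
      using that by simp
    show ?thesis
      unfolding bivar_normal_density_def prod.case quad frac[OF d] using d by simp
  qed
  fix A :: "(real \<times> real) set" assume "A \<in> sets (bivar_normal r)"
  then have A [measurable]: "A \<in> sets borel" by simp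
  let ?A' = "?T -` A \<inter> space (bivar_normal 0)"
  have "emeasure (bivar_normal r) A = (\<integral>\<^sup>+z. ennreal (bivar_normal_density r z) * indicator A z \<partial>lborel)"
    unfolding bivar_normal_def by (rule emeasure_density) (use A in auto)
  also have "\<dots> = ennreal (2 * a * b) * (\<integral>\<^sup>+z. ennreal (bivar_normal_density r (a * fst z + b * snd z, a * fst z - b * snd z))
      * indicator A (a * fst z + b * snd z, a * fst z - b * snd z) \<partial>lborel)"
    using ab by (intro nn_integral_rotate_scale) auto
  also have "\<dots> = (\<integral>\<^sup>+z. ennreal (2 * a * b) * (ennreal (bivar_normal_density r (a * fst z + b * snd z, a * fst z - b * snd z))
      * indicator A (a * fst z + b * snd z, a * fst z - b * snd z)) \<partial>lborel)"
    by (intro nn_integral_cmult[symmetric]) measurable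
  also have "\<dots> = (\<integral>\<^sup>+z. ennreal (bivar_normal_density 0 z) * indicator (?T -` A) z \<partial>lborel)"
  proof (intro nn_integral_cong)
    fix z :: "real \<times> real"
    have "ennreal (2 * a * b) * ennreal (bivar_normal_density r (a * fst z + b * snd z, a * fst z - b * snd z))
        = ennreal (bivar_normal_density 0 z)"
      unfolding tab using d dens[of "fst z" "snd z"] by (subst ennreal_mult'[symmetric]) simp_all
    then show "ennreal (2 * a * b) * (ennreal (bivar_normal_density r (a * fst z + b * snd z, a * fst z - b * snd z))
        * indicator A (a * fst z + b * snd z, a * fst z - b * snd z)) = ennreal (bivar_normal_density 0 z) * indicator (?T -` A) z"
      unfolding mult.assoc[symmetric] T by (simp add: indicator_def)
  qed
  also have "\<dots> = emeasure (bivar_normal 0) (?T -` A)"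
    unfolding bivar_normal_def T
    using measurable_sets_borel[OF T_meas A] by (intro emeasure_density[symmetric]) auto
  also have "\<dots> = emeasure (distr (bivar_normal 0) borel ?T) A"
    unfolding T using A by (subst emeasure_distr) auto
  finally show "emeasure (bivar_normal r) A = emeasure (distr (bivar_normal 0) borel ?T) A" .
qed simp

text \<open>Moves r from the measure into the integrand, so that values of f at two correlations can
  be compared pointwise under one measure.\<close>

lemma f_fun_eq_standard_normal:
  assumes r: "\<bar>r\<bar> < 1" and p: "0 \<le> p" "p \<le> 1"
  shows "f_fun p r = (\<integral>z. signed_pow (((1 + r) * (fst z)\<^sup>2 - (1 - r) * (snd z)\<^sup>2) / 2) p \<partial>bivar_normal 0)"
    and "integrable (bivar_normal 0) (\<lambda>z. signed_pow (((1 + r) * (fst z)\<^sup>2 - (1 - r) * (snd z)\<^sup>2) / 2) p)"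
proof -
  let ?T = "\<lambda>z::real\<times>real. (sqrt ((1 + r) / 2) * fst z + sqrt ((1 - r) / 2) * snd z, sqrt ((1 + r) / 2) * fst z - sqrt ((1 - r) / 2) * snd z)"
  have T: "?T \<in> borel_measurable (bivar_normal 0)"
    unfolding measurable_cong_sets[OF sets_bivar_normal refl] unfolding borel_prod[symmetric] by measurable
  have prod: "fst (?T z) * snd (?T z) = ((1 + r) * (fst z)\<^sup>2 - (1 - r) * (snd z)\<^sup>2) / 2" for z
  proof -
    have "fst (?T z) * snd (?T z) = (sqrt ((1 + r) / 2))\<^sup>2 * (fst z)\<^sup>2 - (sqrt ((1 - r) / 2))\<^sup>2 * (snd z)\<^sup>2"
      by (simp only: fst_conv snd_conv power2_eq_square) (simp add: algebra_simps)
    then show ?thesis using r by (simp add: diff_divide_distrib)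
  qed
  show "f_fun p r = (\<integral>z. signed_pow (((1 + r) * (fst z)\<^sup>2 - (1 - r) * (snd z)\<^sup>2) / 2) p \<partial>bivar_normal 0)"
    unfolding f_fun_def prod[symmetric]
    by (subst bivar_normal_eq_distr[OF r], subst integral_distr[OF T]) auto
  show "integrable (bivar_normal 0) (\<lambda>z. signed_pow (((1 + r) * (fst z)\<^sup>2 - (1 - r) * (snd z)\<^sup>2) / 2) p)"
    unfolding prod[symmetric]
    using integrable_signed_pow_bivar_normal(1)[OF r p] bivar_normal_eq_distr[OF r]
    by (subst integrable_distr_eq[OF T, symmetric]) auto
qed

text \<open>The density is positive everywhere and nonempty open sets are not Lebesgue null. This
  excludes the degenerate cases below.\<close>

lemma not_AE_bivar_normal_False:
  assumes r: "\<bar>r\<bar> < 1" and O: "open S" "S \<noteq> {}"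
  shows "\<not> (AE z in bivar_normal r. z \<notin> S)"
proof
  assume "AE z in bivar_normal r. z \<notin> S"
  then have "AE z in lborel. z \<notin> S"
    unfolding bivar_normal_def using bivar_normal_density_pos[OF r]
    by (subst (asm) AE_density) auto
  then have "S \<in> null_sets lborel"
    using O by (subst (asm) AE_iff_null_sets[symmetric]) auto
  then show False
    using O open_not_negligible null_sets_completionI negligible_iff_null_sets by metis
qed

text \<open>Put S = U^2 + V^2. The polarized products at r and s differ by (s - r) S/2 and are
  bounded by S, so the lower slope bound with m = S gives an increment of at least p S^(p-1) (s - r)
  S/2. Its mean is K (s - r) with K = (p/2) E[S^p], independent of r and s.\<close>

lemma f_fun_diff_ge:
  assumes p: "0 < p" "p \<le> 1"
  obtains K where "0 < K" "\<And>r s. -1 < r \<Longrightarrow> r \<le> s \<Longrightarrow> s < 1 \<Longrightarrow> K * (s - r) \<le> f_fun p s - f_fun p r"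
proof -
  define S where "S z = (fst z)\<^sup>2 + (snd z)\<^sup>2" for z :: "real \<times> real"
  define w where "w r z = ((1 + r) * (fst z)\<^sup>2 - (1 - r) * (snd z)\<^sup>2) / 2" for r and z :: "real \<times> real"
  define K where "K = (\<integral>z. p / 2 * S z powr p \<partial>bivar_normal 0)"
  have S0: "0 \<le> S z" for z by (simp add: S_def)
  have int: "integrable (bivar_normal 0) (\<lambda>z. p / 2 * S z powr p)"
  proof (intro integrable_mult_right integrable_bivar_normal(2))
    show "(\<lambda>z. S z powr p) \<in> borel_measurable borel" unfolding S_def by measurable
    show "\<bar>S z powr p\<bar> \<le> (1 + ((fst z)\<^sup>2 + (snd z)\<^sup>2)) ^ 3" for z
      using powr_le_one_plus[OF S0, of p z] le_one_plus_power3(1)[OF S0, of z] p by (simp add: S_def)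
  qed auto
  have "K \<noteq> 0"
  proof
    assume "K = 0"
    then have "AE z in bivar_normal 0. p / 2 * S z powr p = 0"
      unfolding K_def using p by (subst (asm) integral_nonneg_eq_0_iff_AE[OF int]) auto
    then have "AE z in bivar_normal 0. z \<notin> - {(0, 0)}"
      using p by (auto simp: S_def sum_power2_eq_zero_iff prod_eq_iff)
    then show False
      using not_AE_bivar_normal_False[of 0 "- {(0, 0)}"] by (auto simp: set_eq_iff intro: exI[of _ "(1, 1)"])
  qed
  moreover have "0 \<le> K"
    unfolding K_def using p by (intro Bochner_Integration.integral_nonneg) auto
  ultimately have K: "0 < K" by simp
  have "K * (s - r) \<le> f_fun p s - f_fun p r" if rs: "-1 < r" "r \<le> s" "s < 1" for r s
  proof -
    have r: "\<bar>r\<bar> < 1" and s: "\<bar>s\<bar> < 1" using rs by auto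
    note fs = f_fun_eq_standard_normal[OF s less_imp_le[OF p(1)] p(2), folded w_def]
    note fr = f_fun_eq_standard_normal[OF r less_imp_le[OF p(1)] p(2), folded w_def]
    have "K * (s - r) = (\<integral>z. p / 2 * S z powr p * (s - r) \<partial>bivar_normal 0)"
      unfolding K_def by simp
    also have "\<dots> \<le> (\<integral>z. signed_pow (w s z) p - signed_pow (w r z) p \<partial>bivar_normal 0)"
    proof (intro integral_mono integrable_mult_left int Bochner_Integration.integrable_diff fs(2) fr(2))
      fix z :: "real \<times> real"
      have w_le: "\<bar>w t z\<bar> \<le> S z" if "\<bar>t\<bar> < 1" for t
      proof -
        have "\<bar>(1 + t) * (fst z)\<^sup>2 - (1 - t) * (snd z)\<^sup>2\<bar> \<le> \<bar>(1 + t) * (fst z)\<^sup>2\<bar> + \<bar>(1 - t) * (snd z)\<^sup>2\<bar>"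
          by (rule abs_triangle_ineq4)
        also have "\<dots> \<le> 2 * (fst z)\<^sup>2 + 2 * (snd z)\<^sup>2"
          using that unfolding abs_mult by (intro add_mono mult_mono) auto
        finally show ?thesis by (simp add: w_def S_def)
      qed
      have w_diff: "w s z - w r z = (s - r) / 2 * S z"
        by (simp add: w_def S_def field_simps)
      have "p * S z powr (p - 1) * (w s z - w r z) \<le> signed_pow (w s z) p - signed_pow (w r z) p"
      proof (rule signed_pow_diff_ge[OF p])
        show "w r z \<le> w s z" using w_diff rs S0[of z] by (smt (verit) divide_nonneg_nonneg mult_nonneg_nonneg)
      qed (use w_le r s in auto)
      moreover have "S z powr (p - 1) * S z = S z powr p"
        using S0[of z] by (cases "S z = 0") (auto simp: powr_diff)
      then have "p * S z powr (p - 1) * (w s z - w r z) = p / 2 * S z powr p * (s - r)"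
        unfolding w_diff by (metis (no_types, opaque_lifting) mult.assoc mult.commute times_divide_eq_left times_divide_eq_right)
      ultimately show "p / 2 * S z powr p * (s - r) \<le> signed_pow (w s z) p - signed_pow (w r z) p"
        by simp
    qed
    also have "\<dots> = f_fun p s - f_fun p r"
      using fs fr by (simp add: Bochner_Integration.integral_diff)
    finally show ?thesis .
  qed
  with K that show thesis by blast
qed

section \<open>Moments of the observations\<close>

lemma signed_pow_sqrt: "0 \<le> a \<Longrightarrow> signed_pow (sqrt a) p = a powr (p / 2)"
  by (cases "a = 0") (auto simp: signed_pow_def powr_half_sqrt[symmetric] powr_powr)

lemma signed_pow_pos: "0 < x \<Longrightarrow> 0 < signed_pow x p"
  by (simp add: signed_pow_def)

lemma signed_pow_neg: "x < 0 \<Longrightarrow> signed_pow x p < 0"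
  by (simp add: signed_pow_def)

lemma signed_pow_square: "(signed_pow x p)\<^sup>2 = \<bar>x\<bar> powr (2 * p)"
proof -
  have "(signed_pow x p)\<^sup>2 = (\<bar>x\<bar> powr p)\<^sup>2"
    using abs_signed_pow[of x p] by (metis power2_abs)
  then show ?thesis by (simp add: power2_eq_square powr_add[symmetric])
qed

text \<open>The difference of the two sides is a variance. It cannot vanish, since the signed
  product is positive on one open quadrant and negative on another, so it is not almost surely
  constant. Here \<open>2 * p <= 1\<close> keeps the square below 1 + |z|^2.\<close>

lemma f_fun_square_less:
  assumes q: "\<bar>q\<bar> < 1" and p: "0 < p" "2 * p \<le> 1" and ps: "prob_space (bivar_normal q)"
  shows "(f_fun p q)\<^sup>2 < (\<integral>z. (signed_pow (fst z * snd z) p)\<^sup>2 \<partial>bivar_normal q)"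
    and "integrable (bivar_normal q) (\<lambda>z. (signed_pow (fst z * snd z) p)\<^sup>2)"
proof -
  interpret prob_space "bivar_normal q" by fact
  let ?h = "\<lambda>z. signed_pow (fst z * snd z) p"
  have int: "integrable (bivar_normal q) ?h"
    using p by (intro integrable_signed_pow_bivar_normal(1)[OF q]) auto
  show int2: "integrable (bivar_normal q) (\<lambda>z. (?h z)\<^sup>2)"
  proof (rule integrable_bivar_normal(2)[OF q])
    show "\<bar>(?h z)\<^sup>2\<bar> \<le> (1 + ((fst z)\<^sup>2 + (snd z)\<^sup>2)) ^ 3" for z
      unfolding signed_pow_square
      using powr_abs_mult_le[of "2 * p" "fst z" "snd z"] le_one_plus_power3(1)[of "(fst z)\<^sup>2 + (snd z)\<^sup>2"] p by auto
  qed measurable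
  have exp: "expectation ?h = f_fun p q" by (simp add: f_fun_def)
  have int3: "integrable (bivar_normal q) (\<lambda>z. (?h z - f_fun p q)\<^sup>2)"
    unfolding power2_diff using int int2 by auto
  have "variance ?h \<noteq> 0"
  proof
    assume "variance ?h = 0"
    then have ae: "AE z in bivar_normal q. ?h z = f_fun p q"
      unfolding exp by (subst (asm) integral_nonneg_eq_0_iff_AE[OF int3]) auto
    show False
    proof (cases "f_fun p q \<le> 0")
      case True
      have "AE z in bivar_normal q. z \<notin> {0<..} \<times> {0<..}"
        using ae
      proof (rule eventually_mono)
        fix z assume "?h z = f_fun p q"
        then show "z \<notin> {0<..} \<times> {0<..}" using True signed_pow_pos[of "fst z * snd z" p] by (cases z) auto
      qed
      then show False
        using not_AE_bivar_normal_False[OF q, of "{0<..} \<times> {0<..}"] by (auto simp: open_Times intro: gt_ex)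
    next
      case False
      have "AE z in bivar_normal q. z \<notin> {0<..} \<times> {..<0}"
        using ae
      proof (rule eventually_mono)
        fix z assume "?h z = f_fun p q"
        then show "z \<notin> {0<..} \<times> {..<0}" using False signed_pow_neg[of "fst z * snd z" p] by (cases z) (auto simp: mult_pos_neg)
      qed
      then show False
        using not_AE_bivar_normal_False[OF q, of "{0<..} \<times> {..<0}"] by (auto simp: open_Times intro: gt_ex lt_ex)
    qed
  qed
  then have "0 < variance ?h"
    using variance_positive[of ?h] by linarith
  then show "(f_fun p q)\<^sup>2 < (\<integral>z. (?h z)\<^sup>2 \<partial>bivar_normal q)"
    using variance_eq[OF int int2] unfolding exp by simp
qed

lemma (in prob_space) indep_var_product_moment:
  fixes f g :: "_ \<Rightarrow> real"
  assumes "indep_var N1 Y N2 Z" "f \<in> borel_measurable N1" "g \<in> borel_measurable N2"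
    and "integrable M (\<lambda>\<omega>. f (Y \<omega>))" "integrable M (\<lambda>\<omega>. g (Z \<omega>))"
  shows "integrable M (\<lambda>\<omega>. f (Y \<omega>) * g (Z \<omega>))"
    and "expectation (\<lambda>\<omega>. f (Y \<omega>) * g (Z \<omega>)) = expectation (\<lambda>\<omega>. f (Y \<omega>)) * expectation (\<lambda>\<omega>. g (Z \<omega>))"
proof -
  have i: "indep_var borel (\<lambda>\<omega>. f (Y \<omega>)) borel (\<lambda>\<omega>. g (Z \<omega>))"
    using indep_var_compose[OF assms(1-3)] by (simp add: comp_def)
  show "integrable M (\<lambda>\<omega>. f (Y \<omega>) * g (Z \<omega>))"
    by (rule indep_var_integrable[OF i assms(4,5)])
  show "expectation (\<lambda>\<omega>. f (Y \<omega>) * g (Z \<omega>)) = expectation (\<lambda>\<omega>. f (Y \<omega>)) * expectation (\<lambda>\<omega>. g (Z \<omega>))"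
    by (rule indep_var_lebesgue_integral[OF i assms(4,5)])
qed

lemma (in prob_space) one_sided_stable_variable_moments:
  assumes A: "A \<in> borel_measurable M" and \<alpha>: "0 < \<alpha>" "\<alpha> < 2"
    and law: "stable_law (\<alpha> / 2) (cos (pi * \<alpha> / 4) powr (2 / \<alpha>)) 1 0 (distr M borel A)"
  shows "AE \<omega> in M. 0 \<le> A \<omega>"
    and "0 < s \<Longrightarrow> s < \<alpha> / 2 \<Longrightarrow> integrable M (\<lambda>\<omega>. A \<omega> powr s)"
    and "0 < s \<Longrightarrow> s < \<alpha> / 2 \<Longrightarrow> 0 < expectation (\<lambda>\<omega>. A \<omega> powr s)"
proof -
  interpret D: real_distribution "distr M borel A"
    using A by (rule real_distribution_distr)
  have a: "0 < \<alpha> / 2" "\<alpha> / 2 < 1" using \<alpha> by auto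
  have law': "stable_law (\<alpha> / 2) (cos (pi * (\<alpha> / 2) / 2) powr (1 / (\<alpha> / 2))) 1 0 (distr M borel A)"
    using law by simp
  note D.one_sided_stable_moments[OF a law']
  then show "AE \<omega> in M. 0 \<le> A \<omega>"
    and "0 < s \<Longrightarrow> s < \<alpha> / 2 \<Longrightarrow> integrable M (\<lambda>\<omega>. A \<omega> powr s)"
    and "0 < s \<Longrightarrow> s < \<alpha> / 2 \<Longrightarrow> 0 < expectation (\<lambda>\<omega>. A \<omega> powr s)"
    using A by (simp_all add: AE_distr_iff integrable_distr_eq integral_distr)
qed

text \<open>Since the signed p-th power of sqrt(A) is A^(p/2), g(X) splits into independent stable
  and Gaussian factors, and C1 C2 normalizes the stable one to mean 1. Its second moment is then at
  least 1 by Jensen, so the strict inequality is inherited from the Gaussian factor.\<close>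

lemma (in prob_space) g_fun_moments:
  fixes A1 A2 G1 G2 :: "'a \<Rightarrow> real" and p q C1 C2 :: real
  assumes q: "\<bar>q\<bar> < 1" and p: "0 < p" "2 * p \<le> 1"
    and A1: "A1 \<in> borel_measurable M" "AE \<omega> in M. 0 \<le> A1 \<omega>" "integrable M (\<lambda>\<omega>. A1 \<omega> powr (p / 2))"
      "integrable M (\<lambda>\<omega>. A1 \<omega> powr p)"
    and A2: "A2 \<in> borel_measurable M" "AE \<omega> in M. 0 \<le> A2 \<omega>" "integrable M (\<lambda>\<omega>. A2 \<omega> powr (p / 2))"
      "integrable M (\<lambda>\<omega>. A2 \<omega> powr p)"
    and A_indep: "indep_var borel A1 borel A2"
    and G_law: "distributed M lborel (\<lambda>\<omega>. (G1 \<omega>, G2 \<omega>)) (\<lambda>z. ennreal (bivar_normal_density q z))"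
    and AG_indep: "indep_var borel (\<lambda>\<omega>. (A1 \<omega>, A2 \<omega>)) borel (\<lambda>\<omega>. (G1 \<omega>, G2 \<omega>))"
    and X: "X = (\<lambda>\<omega>. (sqrt (A1 \<omega>) * G1 \<omega>, sqrt (A2 \<omega>) * G2 \<omega>))"
    and C1: "C1 = expectation (\<lambda>\<omega>. A1 \<omega> powr (p / 2))" "0 < C1"
    and C2: "C2 = expectation (\<lambda>\<omega>. A2 \<omega> powr (p / 2))" "0 < C2"
  shows "X \<in> borel_measurable M"
    and "integrable M (\<lambda>\<omega>. (g_fun p C1 C2 (X \<omega>))\<^sup>2)"
    and "expectation (\<lambda>\<omega>. g_fun p C1 C2 (X \<omega>)) = f_fun p q"
    and "(f_fun p q)\<^sup>2 < expectation (\<lambda>\<omega>. (g_fun p C1 C2 (X \<omega>))\<^sup>2)"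
proof -
  have G_meas [measurable]: "(\<lambda>\<omega>. (G1 \<omega>, G2 \<omega>)) \<in> borel_measurable M"
    using distributed_measurable[OF G_law] by simp
  have Gd: "distr M borel (\<lambda>\<omega>. (G1 \<omega>, G2 \<omega>)) = bivar_normal q"
    using distributed_distr_eq_density[OF G_law] unfolding bivar_normal_def
    by (simp add: distr_cong[OF refl sets_lborel refl])
  have ps: "prob_space (bivar_normal q)"
    unfolding Gd[symmetric] by (rule prob_space_distr) measurable
  have G1 [measurable]: "G1 \<in> borel_measurable M" and G2 [measurable]: "G2 \<in> borel_measurable M"
    using borel_measurable_fst_snd[OF G_meas] by simp_all
  note [measurable] = A1(1) A2(1)
  show X_meas: "X \<in> borel_measurable M"
    unfolding X borel_prod[symmetric] by measurable
  let ?h = "\<lambda>z. signed_pow (fst z * snd z) p"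
  have hi: "integrable M (\<lambda>\<omega>. ?h (G1 \<omega>, G2 \<omega>))" "expectation (\<lambda>\<omega>. ?h (G1 \<omega>, G2 \<omega>)) = f_fun p q"
    using integrable_signed_pow_bivar_normal(1)[OF q, of p] p
    unfolding Gd[symmetric] f_fun_def by (simp_all add: integrable_distr_eq integral_distr)
  note fs = f_fun_square_less[OF q p ps]
  have h2i: "integrable M (\<lambda>\<omega>. (?h (G1 \<omega>, G2 \<omega>))\<^sup>2)"
      "(f_fun p q)\<^sup>2 < expectation (\<lambda>\<omega>. (?h (G1 \<omega>, G2 \<omega>))\<^sup>2)"
    using fs unfolding Gd[symmetric]
    by (simp_all add: integrable_distr_eq integral_distr)
  let ?k = "\<lambda>s z :: real \<times> real. fst z powr s * snd z powr s"
  have k_meas: "?k s \<in> borel_measurable borel" for s by measurable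
  have ki: "integrable M (\<lambda>\<omega>. ?k s (A1 \<omega>, A2 \<omega>))"
     "expectation (\<lambda>\<omega>. ?k s (A1 \<omega>, A2 \<omega>)) = expectation (\<lambda>\<omega>. A1 \<omega> powr s) * expectation (\<lambda>\<omega>. A2 \<omega> powr s)"
    if "integrable M (\<lambda>\<omega>. A1 \<omega> powr s)" "integrable M (\<lambda>\<omega>. A2 \<omega> powr s)" for s
    using indep_var_product_moment[OF A_indep _ _ that] by simp_all
  note m1 = indep_var_product_moment[OF AG_indep k_meas signed_pow_prod_measurable ki(1)[OF A1(3) A2(3)] hi(1)]
  have h2_meas: "(\<lambda>z. (?h z)\<^sup>2) \<in> borel_measurable (borel :: (real \<times> real) measure)" by measurable
  note m2 = indep_var_product_moment[OF AG_indep k_meas h2_meas ki(1)[OF A1(4) A2(4)] h2i(1)]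
  \<comment> \<open>Only almost everywhere: \<open>sqrt\<close> is odd on the reals, so a negative
    value of \<open>A1\<close> or \<open>A2\<close> could spoil the sign.\<close>
  have g_eq: "AE \<omega> in M. g_fun p C1 C2 (X \<omega>) = ?k (p / 2) (A1 \<omega>, A2 \<omega>) * ?h (G1 \<omega>, G2 \<omega>) / (C1 * C2)"
    using A1(2) A2(2) by eventually_elim (simp add: X g_fun_def signed_pow_sqrt signed_pow_mult)
  have sq: "(x powr (p / 2))\<^sup>2 = x powr p" for x :: real
    by (simp add: power2_eq_square powr_add[symmetric])
  have g2_eq: "AE \<omega> in M. (g_fun p C1 C2 (X \<omega>))\<^sup>2 = ?k p (A1 \<omega>, A2 \<omega>) * (?h (G1 \<omega>, G2 \<omega>))\<^sup>2 / (C1 * C2)\<^sup>2"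
    using g_eq by eventually_elim (simp add: power_mult_distrib power_divide sq)
  have gX_meas [measurable]: "(\<lambda>\<omega>. g_fun p C1 C2 (X \<omega>)) \<in> borel_measurable M"
    unfolding g_fun_def using X_meas by measurable
  show "expectation (\<lambda>\<omega>. g_fun p C1 C2 (X \<omega>)) = f_fun p q"
  proof -
    have "expectation (\<lambda>\<omega>. g_fun p C1 C2 (X \<omega>))
        = expectation (\<lambda>\<omega>. ?k (p / 2) (A1 \<omega>, A2 \<omega>) * ?h (G1 \<omega>, G2 \<omega>) / (C1 * C2))"
      using g_eq borel_measurable_integrable[OF m1(1)] by (intro integral_cong_AE) auto
    also have "\<dots> = f_fun p q"
      unfolding Bochner_Integration.integral_divide_zero m1(2) ki(2)[OF A1(3) A2(3)] hi(2) C1(1)[symmetric] C2(1)[symmetric]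
      using C1(2) C2(2) by simp
    finally show ?thesis .
  qed
  show "integrable M (\<lambda>\<omega>. (g_fun p C1 C2 (X \<omega>))\<^sup>2)"
    by (subst integrable_cong_AE[OF _ _ g2_eq]) (use borel_measurable_integrable[OF m2(1)] m2(1) in auto)
  have jensen: "(expectation (\<lambda>\<omega>. A \<omega> powr (p / 2)))\<^sup>2 \<le> expectation (\<lambda>\<omega>. A \<omega> powr p)"
    if "integrable M (\<lambda>\<omega>. A \<omega> powr (p / 2))" "integrable M (\<lambda>\<omega>. A \<omega> powr p)" for A
    using variance_eq[of "\<lambda>\<omega>. A \<omega> powr (p / 2)"] variance_positive[of "\<lambda>\<omega>. A \<omega> powr (p / 2)"] that
    by (simp add: sq)
  have "expectation (\<lambda>\<omega>. (g_fun p C1 C2 (X \<omega>))\<^sup>2)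
      = expectation (\<lambda>\<omega>. ?k p (A1 \<omega>, A2 \<omega>) * (?h (G1 \<omega>, G2 \<omega>))\<^sup>2 / (C1 * C2)\<^sup>2)"
    using g2_eq borel_measurable_integrable[OF m2(1)] by (intro integral_cong_AE) auto
  also have "\<dots> = expectation (\<lambda>\<omega>. A1 \<omega> powr p) * expectation (\<lambda>\<omega>. A2 \<omega> powr p) / (C1 * C2)\<^sup>2 * expectation (\<lambda>\<omega>. (?h (G1 \<omega>, G2 \<omega>))\<^sup>2)"
    unfolding Bochner_Integration.integral_divide_zero m2(2) ki(2)[OF A1(4) A2(4)] by simp
  \<comment> \<open>The chain turns here: the dots still stand for the second moment of g, now
    bounded from below by that of the Gaussian factor.\<close>
  also have "1 * expectation (\<lambda>\<omega>. (?h (G1 \<omega>, G2 \<omega>))\<^sup>2) \<le> \<dots>"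
  proof (rule mult_right_mono)
    have "C1\<^sup>2 * C2\<^sup>2 \<le> expectation (\<lambda>\<omega>. A1 \<omega> powr p) * expectation (\<lambda>\<omega>. A2 \<omega> powr p)"
      using jensen[OF A1(3,4)] jensen[OF A2(3,4)] unfolding C1(1)[symmetric] C2(1)[symmetric]
      by (intro mult_mono order_trans[OF zero_le_power2]) auto
    then show "1 \<le> expectation (\<lambda>\<omega>. A1 \<omega> powr p) * expectation (\<lambda>\<omega>. A2 \<omega> powr p) / (C1 * C2)\<^sup>2"
      using C1(2) C2(2) by (simp add: power_mult_distrib)
  qed simp
  finally show "(f_fun p q)\<^sup>2 < expectation (\<lambda>\<omega>. (g_fun p C1 C2 (X \<omega>))\<^sup>2)"
    using h2i(2) by simp
qed

section \<open>Central limit theorem and delta method\<close>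

text \<open>Skorohod's representation replaces weak convergence by pointwise convergence, under
  which the maps \<open>k n\<close> converge along convergent arguments. Beyond measurability, h is
  constrained only by its derivative at y; this suits an inverse extended arbitrarily outside a
  range.\<close>

lemma (in prob_space) weak_conv_delta_method:
  fixes Y :: "nat \<Rightarrow> 'a \<Rightarrow> real" and h :: "real \<Rightarrow> real"
  assumes N: "real_distribution N"
    and Y [measurable]: "\<And>n. Y n \<in> borel_measurable M"
    and h [measurable]: "h \<in> borel_measurable borel"
    and deriv: "(h has_field_derivative D) (at y)"
    and conv: "weak_conv_m (\<lambda>n. distr M borel (\<lambda>\<omega>. sqrt (real n) * (Y n \<omega> - y))) N"
  shows "weak_conv_m (\<lambda>n. distr M borel (\<lambda>\<omega>. sqrt (real n) * (h (Y n \<omega>) - h y))) (distr N borel (\<lambda>w. D * w))"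
proof -
  \<comment> \<open>\<open>k n\<close> undoes the normalization, applies h and normalizes again. At
    n = 0 the factor \<open>sqrt 0\<close> makes both expressions 0.\<close>
  define k where "k n w = sqrt (real n) * (h (y + w / sqrt (real n)) - h y)" for n w
  have k_meas [measurable]: "k n \<in> borel_measurable borel" for n
    unfolding k_def by measurable
  \<comment> \<open>Caratheodory's form of the derivative gives \<open>k n w\<close> as \<phi> at
    the shifted point times w, with no remainder term to estimate.\<close>
  obtain \<phi> where \<phi>: "\<And>z. h z - h y = \<phi> z * (z - y)" "isCont \<phi> y" "\<phi> y = D"
    using deriv unfolding CARAT_DERIV by blast
  have k_conv: "(\<lambda>n. k n (w n)) \<longlonglongrightarrow> D * v" if "w \<longlonglongrightarrow> v" for w v
  proof -
    have "(\<lambda>n. w n * inverse (sqrt (real n))) \<longlonglongrightarrow> v * 0"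
      by (intro tendsto_mult that tendsto_inverse_0_at_top filterlim_compose[OF sqrt_at_top filterlim_real_sequentially])
    then have "(\<lambda>n. y + w n / sqrt (real n)) \<longlonglongrightarrow> y"
      using tendsto_add[OF tendsto_const[of y]] by (fastforce simp: divide_inverse)
    then have "(\<lambda>n. \<phi> (y + w n / sqrt (real n))) \<longlonglongrightarrow> D"
      using isCont_tendsto_compose[OF \<phi>(2)] \<phi>(3) by simp
    then have "(\<lambda>n. \<phi> (y + w n / sqrt (real n)) * w n) \<longlonglongrightarrow> D * v"
      by (intro tendsto_mult that)
    moreover have "\<forall>\<^sub>F n in sequentially. \<phi> (y + w n / sqrt (real n)) * w n = k n (w n)"
      by (intro eventually_sequentiallyI[of 1]) (simp add: k_def \<phi>(1))
    ultimately show ?thesis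
      by (rule Lim_transform_eventually)
  qed
  interpret N: real_distribution N by fact
  define \<mu> where "\<mu> n = distr M borel (\<lambda>\<omega>. sqrt (real n) * (Y n \<omega> - y))" for n
  have \<mu>: "real_distribution (\<mu> n)" for n
    unfolding \<mu>_def by (intro real_distribution_distr) measurable
  obtain \<Omega> :: "real measure" and W V where \<Omega>: "prob_space \<Omega>"
    and W [measurable]: "\<And>n. W n \<in> borel_measurable \<Omega>" and W_distr: "\<And>n. distr \<Omega> borel (W n) = \<mu> n"
    and V [measurable]: "V \<in> borel_measurable \<Omega>" and V_distr: "distr \<Omega> borel V = N"
    and WV: "\<And>x. x \<in> space \<Omega> \<Longrightarrow> (\<lambda>n. W n x) \<longlonglongrightarrow> V x"
    using Skorohod[OF \<mu> N conv[folded \<mu>_def]] by force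
  interpret \<Omega>: prob_space \<Omega> by fact
  have lhs: "distr M borel (\<lambda>\<omega>. sqrt (real n) * (h (Y n \<omega>) - h y)) = distr \<Omega> borel (\<lambda>x. k n (W n x))" for n
  proof -
    have "distr \<Omega> borel (\<lambda>x. k n (W n x)) = distr (distr \<Omega> borel (W n)) borel (k n)"
      by (subst distr_distr) (auto simp: comp_def)
    also have "\<dots> = distr M borel (\<lambda>\<omega>. k n (sqrt (real n) * (Y n \<omega> - y)))"
      unfolding W_distr \<mu>_def by (subst distr_distr) (auto simp: comp_def)
    also have "(\<lambda>\<omega>. k n (sqrt (real n) * (Y n \<omega> - y))) = (\<lambda>\<omega>. sqrt (real n) * (h (Y n \<omega>) - h y))"
      by (cases "n = 0") (auto simp: k_def)
    finally show ?thesis by simp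
  qed
  have rhs: "distr N borel (\<lambda>w. D * w) = distr \<Omega> borel (\<lambda>x. D * V x)"
    unfolding V_distr[symmetric] by (subst distr_distr) (auto simp: comp_def)
  show ?thesis
    unfolding lhs rhs
  proof (rule integral_bdd_continuous_conv_imp_weak_conv)
    show "real_distribution (distr \<Omega> borel (\<lambda>x. k n (W n x)))" for n
      by (intro \<Omega>.real_distribution_distr) measurable
    show "real_distribution (distr \<Omega> borel (\<lambda>x. D * V x))"
      by (intro \<Omega>.real_distribution_distr) measurable
    fix f :: "real \<Rightarrow> real" assume f: "\<And>x. isCont f x" "\<And>x. \<bar>f x\<bar> \<le> 1"
    have [measurable]: "f \<in> borel_measurable borel"
      using f(1) by (intro borel_measurable_continuous_onI continuous_at_imp_continuous_on) auto
    have "(\<lambda>n. \<integral>x. f (k n (W n x)) \<partial>\<Omega>) \<longlonglongrightarrow> (\<integral>x. f (D * V x) \<partial>\<Omega>)"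
    proof (rule integral_dominated_convergence[where w = "\<lambda>_. 1"])
      show "AE x in \<Omega>. (\<lambda>n. f (k n (W n x))) \<longlonglongrightarrow> f (D * V x)"
        using k_conv[OF WV] isCont_tendsto_compose[OF f(1)] by (intro AE_I2) blast
    qed (use f(2) in auto)
    then show "(\<lambda>n. integral\<^sup>L (distr \<Omega> borel (\<lambda>x. k n (W n x))) f) \<longlonglongrightarrow> integral\<^sup>L (distr \<Omega> borel (\<lambda>x. D * V x)) f"
      by (simp add: integral_distr)
  qed
qed

lemma distr_std_normal_mult:
  assumes "c \<noteq> 0"
  shows "distr std_normal_distribution borel (\<lambda>x. c * x) = density lborel (\<lambda>x. ennreal (normal_density 0 \<bar>c\<bar> x))"
proof -
  interpret prob_space std_normal_distribution
    by (rule prob_space_normal_density) simp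
  have "distributed std_normal_distribution lborel (\<lambda>x. x) (\<lambda>x. ennreal (std_normal_density x))"
    by (auto simp: distributed_def intro!: distr_id2)
  from normal_density_affine[OF this, of c 0] assms
  have "distr std_normal_distribution lborel (\<lambda>x. c * x) = density lborel (\<lambda>x. ennreal (normal_density 0 \<bar>c\<bar> x))"
    by (simp add: distributed_def)
  then show ?thesis
    by (simp add: distr_cong[OF refl sets_lborel refl])
qed

text \<open>The central limit theorem comes with limit N(0, 1). The delta method is therefore
  applied at 0 to the standardized error, with \<sigma> absorbed into the function v -> h(m +
  \<sigma> v), whose derivative at 0 is D \<sigma>.\<close>

lemma (in prob_space) central_limit_delta_method:
  fixes Y :: "nat \<Rightarrow> 'a \<Rightarrow> real" and h :: "real \<Rightarrow> real"
  assumes indep: "indep_vars (\<lambda>_. borel) Y UNIV"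
    and distr: "\<And>n. distr M borel (Y n) = \<nu>"
    and sq: "integrable M (\<lambda>\<omega>. (Y 0 \<omega>)\<^sup>2)"
    and mean: "expectation (Y 0) = m"
    and var: "variance (Y 0) = \<sigma>\<^sup>2" "0 < \<sigma>"
    and h: "h \<in> borel_measurable borel"
    and deriv: "(h has_field_derivative D) (at m)" "D \<noteq> 0"
  shows "weak_conv_m (\<lambda>n. distr M borel (\<lambda>\<omega>. sqrt (real n) * (h (1 / real n * (\<Sum>i<n. Y i \<omega>)) - h m)))
    (density lborel (\<lambda>x. ennreal (normal_density 0 (\<bar>D * \<sigma>\<bar>) x)))"
proof -
  have Y [measurable]: "Y n \<in> borel_measurable M" for n
    using indep unfolding indep_vars_def2 by simp
  have via_distr: "integrable M (\<lambda>\<omega>. f (Y n \<omega>)) \<longleftrightarrow> integrable M (\<lambda>\<omega>. f (Y 0 \<omega>))"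
      "expectation (\<lambda>\<omega>. f (Y n \<omega>)) = expectation (\<lambda>\<omega>. f (Y 0 \<omega>))"
    if "f \<in> borel_measurable borel" for f :: "real \<Rightarrow> real" and n
    using distr[of n] distr[of 0] integrable_distr_eq[OF Y that] integral_distr[OF Y that] by metis+
  have clt: "weak_conv_m (\<lambda>n. distr M borel (\<lambda>x. (\<Sum>i<n. Y i x - m) / sqrt (n * \<sigma>\<^sup>2))) std_normal_distribution"
  proof (rule central_limit_theorem[OF indep _ var(2) _ _ distr])
    show m: "expectation (Y n) = m" for n
      using via_distr(2)[of "\<lambda>x. x" n] mean by simp
    show "integrable M (\<lambda>\<omega>. (Y n \<omega>)\<^sup>2)" for n
      using via_distr(1)[of "\<lambda>x. x\<^sup>2" n] sq by simp
    show "variance (Y n) = \<sigma>\<^sup>2" for n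
      using via_distr(2)[of "\<lambda>x. (x - m)\<^sup>2" n] var(1) by (simp add: m)
  qed
  define Z where "Z n \<omega> = (1 / real n * (\<Sum>i<n. Y i \<omega>) - m) / \<sigma>" for n \<omega>
  have "(\<Sum>i<n. Y i \<omega> - m) / sqrt (n * \<sigma>\<^sup>2) = sqrt (real n) * (Z n \<omega> - 0)" for n \<omega>
  proof (cases "n = 0")
    case False
    have sqrt_var: "sqrt (n * \<sigma>\<^sup>2) = sqrt (real n) * \<sigma>"
      using var(2) by (simp add: real_sqrt_mult)
    have cancel: "s * s * a / (s * \<sigma>) = s * (a / \<sigma>)" if "s \<noteq> 0" for s a :: real
      using that by simp
    have centred: "(\<Sum>i<n. Y i \<omega> - m) = sqrt (real n) * sqrt (real n) * (1 / real n * (\<Sum>i<n. Y i \<omega>) - m)"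
      using False by (simp add: sum_subtractf right_diff_distrib)
    show ?thesis
      unfolding Z_def diff_zero centred sqrt_var by (rule cancel) (use False in simp)
  qed simp
  then have "weak_conv_m (\<lambda>n. distr M borel (\<lambda>\<omega>. sqrt (real n) * (Z n \<omega> - 0))) std_normal_distribution"
    using clt by simp
  then have "weak_conv_m (\<lambda>n. distr M borel (\<lambda>\<omega>. sqrt (real n) * (h (m + \<sigma> * Z n \<omega>) - h (m + \<sigma> * 0))))
      (distr std_normal_distribution borel (\<lambda>w. (D * \<sigma>) * w))"
  proof (rule weak_conv_delta_method[where h = "\<lambda>v. h (m + \<sigma> * v)", rotated 4])
    show "real_distribution std_normal_distribution" by (rule real_dist_normal_dist)
    show "Z n \<in> borel_measurable M" for n unfolding Z_def by measurable
    show "(\<lambda>v. h (m + \<sigma> * v)) \<in> borel_measurable borel" using h by measurable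
    show "((\<lambda>v. h (m + \<sigma> * v)) has_field_derivative D * \<sigma>) (at 0)"
      by (rule DERIV_chain2[where f = h]) (use deriv in \<open>auto intro!: derivative_eq_intros\<close>)
  qed
  moreover have "m + \<sigma> * Z n \<omega> = 1 / real n * (\<Sum>i<n. Y i \<omega>)" for n \<omega>
    using var(2) by (simp add: Z_def)
  moreover have "D * \<sigma> \<noteq> 0" using deriv(2) var(2) by simp
  ultimately show ?thesis
    by (simp add: distr_std_normal_mult)
qed

text \<open>The linear lower bound on increments gives injectivity and a Lipschitz inverse.
  Invariance of domain makes the range open, so near f(q) the default value c is invisible, and
  globally \<open>f_inv\<close> is continuous on an open set and constant off it, hence
  Borel.\<close>

lemma f_inv_properties:
  assumes p: "0 < p" "p \<le> 1" and q: "-1 < q" "q < 1"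
  shows "f_inv p c (f_fun p q) = q"
    and "f_inv p c \<in> borel_measurable borel"
    and "0 < deriv (f_fun p) q"
    and "(f_inv p c has_field_derivative inverse (deriv (f_fun p) q)) (at (f_fun p q))"
proof -
  let ?I = "{-1<..<1::real}"
  let ?R = "f_fun p ` ?I"
  obtain K where K: "0 < K" and diff_ge: "\<And>r s. -1 < r \<Longrightarrow> r \<le> s \<Longrightarrow> s < 1 \<Longrightarrow> K * (s - r) \<le> f_fun p s - f_fun p r"
    using f_fun_diff_ge[OF p] by blast
  have abs_ge: "K * \<bar>s - r\<bar> \<le> \<bar>f_fun p s - f_fun p r\<bar>" if "r \<in> ?I" "s \<in> ?I" for r s
    using diff_ge[of r s] diff_ge[of s r] that by (cases "r \<le> s") auto
  have inj: "inj_on (f_fun p) ?I"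
  proof (rule inj_onI)
    fix r s assume "r \<in> ?I" "s \<in> ?I" "f_fun p r = f_fun p s"
    then have "K * \<bar>s - r\<bar> \<le> 0" using abs_ge[of r s] by simp
    then show "r = s" using K by (simp add: mult_le_0_iff)
  qed
  have deriv: "(f_fun p has_field_derivative deriv (f_fun p) r) (at r)" if "r \<in> ?I" for r
    using f_fun_differentiable[of r p] that p by (simp add: field_differentiable_derivI abs_less_iff)
  have cont: "continuous_on ?I (f_fun p)"
    using deriv by (intro continuous_at_imp_continuous_on) (blast intro: DERIV_isCont)
  have open_R: "open ?R"
    by (rule invariance_of_domain[OF cont _ inj]) simp
  have inv: "f_inv p c (f_fun p r) = r" if "r \<in> ?I" for r
    using that inj by (simp add: f_inv_def)
  then show "f_inv p c (f_fun p q) = q" using q by simp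
  have "(1 / K)-lipschitz_on ?R (f_inv p c)"
  proof (rule lipschitz_onI)
    fix x y assume "x \<in> ?R" "y \<in> ?R"
    then obtain r s where rs: "x = f_fun p r" "y = f_fun p s" "r \<in> ?I" "s \<in> ?I" by blast
    then show "dist (f_inv p c x) (f_inv p c y) \<le> 1 / K * dist x y"
      using abs_ge[of s r] K by (simp add: inv dist_real_def field_simps)
  qed (use K in simp)
  then have cont_inv: "continuous_on ?R (f_inv p c)"
    by (rule lipschitz_on_continuous_on)
  have "(\<lambda>y. if y \<in> ?R then f_inv p c y else c) \<in> borel_measurable borel"
    using open_R by (intro borel_measurable_continuous_on_if cont_inv) auto
  moreover have "(\<lambda>y. if y \<in> ?R then f_inv p c y else c) = f_inv p c"
    by (auto simp: f_inv_def)
  ultimately show "f_inv p c \<in> borel_measurable borel" by simp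
  \<comment> \<open>Increments of at least K (s - r) mean that f minus K r is monotone, so the
    derivative of f is at least K > 0.\<close>
  have "mono_on ?I (\<lambda>r. f_fun p r - K * r)"
    using diff_ge by (fastforce intro!: mono_onI simp: right_diff_distrib)
  moreover have "((\<lambda>r. f_fun p r - K * r) has_real_derivative deriv (f_fun p) q - K) (at q)"
    using deriv[of q] q by (auto intro!: derivative_eq_intros)
  ultimately have "0 \<le> deriv (f_fun p) q - K"
    using q by (intro mono_on_imp_deriv_nonneg) auto
  then show pos: "0 < deriv (f_fun p) q" using K by simp
  have fq: "f_fun p q \<in> ?R" using q by simp
  obtain e where e: "0 < e" "ball (f_fun p q) e \<subseteq> ?R"
    using open_R fq open_contains_ball by blast
  show "(f_inv p c has_field_derivative inverse (deriv (f_fun p) q)) (at (f_fun p q))"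
  proof (rule DERIV_inverse_function[where f = "f_fun p"])
    show "(f_fun p has_field_derivative deriv (f_fun p) q) (at (f_inv p c (f_fun p q)))"
      using deriv[of q] inv[of q] q by simp
    show "f_fun p q - e < f_fun p q" "f_fun p q < f_fun p q + e" using e by auto
    show "f_fun p (f_inv p c y) = y" if "f_fun p q - e < y" "y < f_fun p q + e" for y
    proof -
      have "y \<in> ball (f_fun p q) e" using that by (auto simp: dist_real_def)
      then show ?thesis using e(2) inv by auto
    qed
    show "isCont (f_inv p c) (f_fun p q)"
      using cont_inv open_R fq continuous_on_eq_continuous_at by blast
  qed (use pos in simp)
qed

section \<open>Reindexing independent families, for shifting the sample 1, 2, ... to 0, 1,
  ..\<close>

lemma (in prob_space) indep_sets_reindex:
  assumes indep: "indep_sets F (f ` I)" and inj: "inj_on f I"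
  shows "indep_sets (\<lambda>i. F (f i)) I"
proof (rule indep_setsI)
  show "F (f i) \<subseteq> events" if "i \<in> I" for i
    using indep that by (auto simp: indep_sets_def)
  fix A J assume J: "J \<noteq> {}" "J \<subseteq> I" "finite J" "\<forall>j\<in>J. A j \<in> F (f j)"
  have inj_J: "inj_on f J" using inj J(2) by (rule inj_on_subset)
  define B where "B k = A (the_inv_into J f k)" for k
  have B: "B (f j) = A j" if "j \<in> J" for j
    using the_inv_into_f_f[OF inj_J that] by (simp add: B_def)
  have "prob (\<Inter>j\<in>J. A j) = prob (\<Inter>k\<in>f ` J. B k)"
    using B by simp
  also have "\<dots> = (\<Prod>k\<in>f ` J. prob (B k))"
    using J B by (intro indep_setsD[OF indep]) auto
  also have "\<dots> = (\<Prod>j\<in>J. prob (A j))"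
    using B by (simp add: prod.reindex[OF inj_J])
  finally show "prob (\<Inter>j\<in>J. A j) = (\<Prod>j\<in>J. prob (A j))" .
qed

lemma (in prob_space) indep_vars_reindex:
  assumes "indep_vars N X (f ` I)" and "inj_on f I"
  shows "indep_vars (\<lambda>i. N (f i)) (\<lambda>i. X (f i)) I"
  using assms(1) indep_sets_reindex[OF _ assms(2)] unfolding indep_vars_def2 by fastforce

lemma g_fun_measurable: "g_fun p C1 C2 \<in> borel_measurable borel"
  unfolding g_fun_def by measurable

theorem proposition3:
  fixes M :: "'a measure"
    and \<alpha>1 \<alpha>2 q p c C1 C2 :: real
    and A1 A2 G1 G2 :: "'a \<Rightarrow> real"
    and X :: "'a \<Rightarrow> real \<times> real"
    and Xs :: "nat \<Rightarrow> 'a \<Rightarrow> real \<times> real"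
  assumes M: "prob_space M"
    and \<alpha>1: "1 < \<alpha>1" "\<alpha>1 < 2"
    and \<alpha>2: "1 < \<alpha>2" "\<alpha>2 < 2"
    and q: "-1 < q" "q < 1"
    and A1_meas: "A1 \<in> borel_measurable M"
    and A2_meas: "A2 \<in> borel_measurable M"
    and A1_law: "stable_law (\<alpha>1 / 2) (cos (pi * \<alpha>1 / 4) powr (2 / \<alpha>1)) 1 0 (distr M borel A1)"
    and A2_law: "stable_law (\<alpha>2 / 2) (cos (pi * \<alpha>2 / 4) powr (2 / \<alpha>2)) 1 0 (distr M borel A2)"
    and A_indep: "prob_space.indep_var M borel A1 borel A2"
    and G_law: "distributed M lborel (\<lambda>\<omega>. (G1 \<omega>, G2 \<omega>)) (\<lambda>z. ennreal (bivar_normal_density q z))"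
    and AG_indep: "prob_space.indep_var M borel (\<lambda>\<omega>. (A1 \<omega>, A2 \<omega>)) borel (\<lambda>\<omega>. (G1 \<omega>, G2 \<omega>))"
    and X: "X = (\<lambda>\<omega>. (sqrt (A1 \<omega>) * G1 \<omega>, sqrt (A2 \<omega>) * G2 \<omega>))"
    and Xs_indep: "prob_space.indep_vars M (\<lambda>_. borel) Xs {1..}"
    and Xs_law: "\<And>t. 1 \<le> t \<Longrightarrow> distr M borel (Xs t) = distr M borel X"
    and p: "0 < p" "p < min \<alpha>1 \<alpha>2 / 4"
    and C1: "C1 = (\<integral>\<omega>. A1 \<omega> powr (p / 2) \<partial>M)"
    and C2: "C2 = (\<integral>\<omega>. A2 \<omega> powr (p / 2) \<partial>M)"
    and c: "-1 < c" "c < 1"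
  shows "weak_conv_m
    (\<lambda>n. distr M borel (\<lambda>\<omega>. sqrt (real n) * (q_hat p C1 C2 c Xs n \<omega> - q)))
    (density lborel (\<lambda>x. ennreal (normal_density 0
       (sqrt (((\<integral>\<omega>. (g_fun p C1 C2 (X \<omega>))\<^sup>2 \<partial>M) - (f_fun p q)\<^sup>2) / (deriv (f_fun p) q)\<^sup>2)) x)))"
proof -
  interpret prob_space M by (rule M)
  let ?g = "g_fun p C1 C2"
  let ?f = "f_fun p q"
  \<comment> \<open>As both indices are below 2, p < 1/2. The orders p/2 and p, for the mean and the
    second moment of g, lie below the stable indices \<alpha>1/2 and \<alpha>2/2.\<close>
  have q': "\<bar>q\<bar> < 1" and p': "2 * p \<le> 1" "p / 2 < \<alpha>1 / 2" "p / 2 < \<alpha>2 / 2" "p < \<alpha>1 / 2" "p < \<alpha>2 / 2"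
    and p2: "0 < p / 2" "p \<le> 1"
    using q p \<alpha>1 \<alpha>2 by auto
  have \<alpha>: "0 < \<alpha>1" "0 < \<alpha>2" using \<alpha>1 \<alpha>2 by auto
  note A1 = one_sided_stable_variable_moments[OF A1_meas \<alpha>(1) \<alpha>1(2) A1_law]
  note A2 = one_sided_stable_variable_moments[OF A2_meas \<alpha>(2) \<alpha>2(2) A2_law]
  note g = g_fun_moments[OF q' p(1) p'(1) A1_meas A1(1) A1(2)[OF p2(1) p'(2)] A1(2)[OF p(1) p'(4)]
      A2_meas A2(1) A2(2)[OF p2(1) p'(3)] A2(2)[OF p(1) p'(5)] A_indep G_law AG_indep X
      C1 A1(3)[OF p2(1) p'(2), folded C1] C2 A2(3)[OF p2(1) p'(3), folded C2]]
  note X_meas = g(1)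
  have gX_meas: "(\<lambda>\<omega>. ?g (X \<omega>)) \<in> borel_measurable M"
    by (rule measurable_compose[OF X_meas g_fun_measurable])
  define Y where "Y i \<omega> = ?g (Xs (Suc i) \<omega>)" for i \<omega>
  have Xs_meas: "Xs (Suc i) \<in> borel_measurable M" for i
    using Xs_indep unfolding indep_vars_def2 by simp
  have Y_meas: "Y i \<in> borel_measurable M" for i
    unfolding Y_def by (rule measurable_compose[OF Xs_meas g_fun_measurable])
  have Y_distr: "distr M borel (Y i) = distr M borel (\<lambda>\<omega>. ?g (X \<omega>))" for i
  proof -
    have "distr M borel (Y i) = distr (distr M borel (Xs (Suc i))) borel ?g"
      using Xs_meas g_fun_measurable by (subst distr_distr) (auto simp: Y_def[abs_def] comp_def)
    also have "\<dots> = distr (distr M borel X) borel ?g"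
      by (subst Xs_law) auto
    also have "\<dots> = distr M borel (\<lambda>\<omega>. ?g (X \<omega>))"
      using X_meas g_fun_measurable by (subst distr_distr) (auto simp: comp_def)
    finally show ?thesis .
  qed
  have Y_int: "integrable M (\<lambda>\<omega>. k (Y 0 \<omega>)) \<longleftrightarrow> integrable M (\<lambda>\<omega>. k (?g (X \<omega>)))"
    "expectation (\<lambda>\<omega>. k (Y 0 \<omega>)) = expectation (\<lambda>\<omega>. k (?g (X \<omega>)))"
    if "k \<in> borel_measurable borel" for k :: "real \<Rightarrow> real"
    using Y_distr[of 0] integrable_distr_eq[OF Y_meas that] integral_distr[OF Y_meas that]
      integrable_distr_eq[OF gX_meas that] integral_distr[OF gX_meas that] by metis+
  have "range Suc = {1..}"
    using greaterThan_0 by (auto simp: atLeast_Suc_greaterThan)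
  then have "indep_vars (\<lambda>_. borel) (\<lambda>i. Xs (Suc i)) UNIV"
    using indep_vars_reindex[of "\<lambda>_. borel" Xs Suc UNIV] Xs_indep by simp
  then have Y_indep: "indep_vars (\<lambda>_. borel) Y UNIV"
    unfolding Y_def[abs_def] by (rule indep_vars_compose2) (rule g_fun_measurable)
  define v where "v = expectation (\<lambda>\<omega>. (?g (X \<omega>))\<^sup>2) - ?f\<^sup>2"
  have v: "0 < v" using g(4) by (simp add: v_def)
  have sq: "integrable M (\<lambda>\<omega>. (Y 0 \<omega>)\<^sup>2)"
    using Y_int(1)[of "\<lambda>x. x\<^sup>2"] g(2) by simp
  have mean: "expectation (Y 0) = ?f"
    using Y_int(2)[of "\<lambda>x. x"] g(3) by simp
  have "variance (Y 0) = v"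
    using variance_eq[OF square_integrable_imp_integrable[OF Y_meas sq] sq] Y_int(2)[of "\<lambda>x. x\<^sup>2"]
    by (simp add: mean v_def)
  then have var: "variance (Y 0) = (sqrt v)\<^sup>2" "0 < sqrt v"
    using v by simp_all
  note inv = f_inv_properties[OF p(1) p2(2) q]
  have "weak_conv_m (\<lambda>n. distr M borel (\<lambda>\<omega>. sqrt (real n) * (f_inv p c (1 / real n * (\<Sum>i<n. Y i \<omega>)) - f_inv p c ?f)))
    (density lborel (\<lambda>x. ennreal (normal_density 0 \<bar>inverse (deriv (f_fun p) q) * sqrt v\<bar> x)))"
    using inv(3) by (intro central_limit_delta_method[OF Y_indep Y_distr sq mean var inv(2) inv(4)]) simp
  moreover have "q_hat p C1 C2 c Xs n \<omega> = f_inv p c (1 / real n * (\<Sum>i<n. Y i \<omega>))" for n \<omega>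
    by (simp add: q_hat_def Y_def sum.atLeast1_atMost_eq)
  \<comment> \<open>\<open>normal_density\<close> takes a standard deviation, so the product from
    the delta method is rewritten as the root of the stated variance.\<close>
  moreover have "\<bar>inverse (deriv (f_fun p) q) * sqrt v\<bar> = sqrt (v / (deriv (f_fun p) q)\<^sup>2)"
    using v inv(3) by (simp add: real_sqrt_divide abs_mult field_simps)
  ultimately show ?thesis
    by (simp add: inv(1) v_def)
qed

end
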